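(* Let $k$ be a field of characteristic $2$, let $E=E_{c^2}$ be an elliptic curve over $k$ in $\mathbf{Z}/4\mathbf{Z}$-normal form $$(X_0+X_1+X_2+X_3)^2=c^2X_0X_2=c^2X_1X_3,\qquad \mathrm{O}=(1:0:0:1),$$ and let $P=(t_0:t_1:t_2:t_3)$ be a fixed point in $E(k)$. The Montgomery endomorphism $\varphi$ on $\mathscr{K}(\Delta_P)\subset\mathscr{K}^2=\mathbb{P}^1\times\mathbb{P}^1$, with coordinate functions $((U_0,U_1),(V_0,V_1))$, is defined by $$\pi_1\circ\varphi((U_0:U_1),(V_0:V_1))=(U_0^4+U_1^4:c\,U_0^2U_1^2),$$ $$\pi_2\circ\varphi((U_0:U_1),(V_0:V_1))=(t_1(U_0V_0+U_1V_1)^2:t_0(U_0V_1+U_1V_0)^2).$$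
   Context: $\mathscr{K}=E/\{[\pm1]\}$ is identified with $\mathbb{P}^1$ via the covering $E\to\mathbb{P}^1$, $(X_0:X_1:X_2:X_3)\mapsto(X_0:X_1)=(X_3:X_2)$; $\overline{Q}$ denotes the image of $Q$ in $\mathscr{K}$. $\Delta_P=\{(Q,R)\in E\times E\mid Q-R=P\}$, and $\mathscr{K}(\Delta_P)$ is the image of $\Delta_P$ in $\mathscr{K}\times\mathscr{K}$. The Montgomery endomorphism of $E\times E$ is $\varphi(Q,R)=(2Q,Q+R)$; it maps $\Delta_P$ to itself, and the Montgomery endomorphism on $\mathscr{K}(\Delta_P)$ is the induced map $(\overline{Q},\overline{R})\mapsto(\overline{2Q},\overline{Q+R})$ for $(Q,R)\in\Delta_P$. The maps $\pi_1,\pi_2$ are the two projections of $\mathscr{K}^2=\mathbb{P}^1\times\mathbb{P}^1$. The same formulas are used for the isomorphic curve $C_c$ in split $\mu_4$-normal form, $(X_0+X_2)^2=c^2X_1X_3$, $(X_1+X_3)^2=c^2X_0X_2$ with identity $(c:1:0:1)$, and a fixed point $S=(s_0:s_1:s_2:s_3)$ on it, by setting $(t_0:t_1)=(cs_0:s_1+s_3)=(s_1+s_3:cs_2)$; the Kummer curve of $C_c$ is identified with the same $\mathscr{K}=\mathbb{P}^1$ by $(X_0:X_1:X_2:X_3)\mapsto(cX_0:X_1+X_3)=(X_1+X_3:cX_2)$.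
   Formalization: The first formula is proved with coefficient c^2 in place of c (the printed c is false unless c=1); the second is asserted where its right side is not (0:0), which is shown to be everywhere unless 2P=O, when it is always (0:0); (t0:t1) means the image of P in K. *)

theory Defs
  imports "HOL-Algebra.Algebraic_Closure_Type"
begin

section \<open>Projective points\<close>

text \<open>
  A point of projective space is the set of all its homogeneous coordinate vectors.  The zero
  vector gives the degenerate class \<open>{0}\<close>, which differs from the class of every actual point.
\<close>

type_synonym 'k P1 = "('k \<times> 'k) set"
type_synonym 'k P3 = "('k \<times> 'k \<times> 'k \<times> 'k) set"

definition proj1 :: "'k::field \<times> 'k \<Rightarrow> 'k P1" where
  "proj1 = (\<lambda>(x0, x1). {(l * x0, l * x1) | l. l \<noteq> 0})"

definition proj3 :: "'k::field \<times> 'k \<times> 'k \<times> 'k \<Rightarrow> 'k P3" where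
  "proj3 = (\<lambda>(x0, x1, x2, x3). {(l * x0, l * x1, l * x2, l * x3) | l. l \<noteq> 0})"

definition coords :: "'a set \<Rightarrow> 'a" where
  "coords Q = (SOME v. v \<in> Q)"


section \<open>The chord-tangent law on a Weierstrass curve\<close>

text \<open>The usual formulas for \<open>y\<^sup>2 + a1 x y + a3 y = x\<^sup>3 + a2 x\<^sup>2 + a4 x + a6\<close> in any characteristic.\<close>

datatype 'k wpoint = At_Infinity | Affine 'k 'k

definition on_weierstrass :: "'k::field \<times> 'k \<times> 'k \<times> 'k \<times> 'k \<Rightarrow> 'k wpoint set" where
  "on_weierstrass = (\<lambda>(a1, a2, a3, a4, a6). insert At_Infinity
     {Affine x y | x y. y^2 + a1 * x * y + a3 * y = x^3 + a2 * x^2 + a4 * x + a6})"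

fun weierstrass_add ::
    "'k::field \<times> 'k \<times> 'k \<times> 'k \<times> 'k \<Rightarrow> 'k wpoint \<Rightarrow> 'k wpoint \<Rightarrow> 'k wpoint" where
  "weierstrass_add _ At_Infinity q = q"
| "weierstrass_add _ p At_Infinity = p"
| "weierstrass_add (a1, a2, a3, a4, a6) (Affine x1 y1) (Affine x2 y2) =
     (if x1 = x2 \<and> y1 + y2 + a1 * x2 + a3 = 0 then At_Infinity
      else
        let m = (if x1 = x2
                 then (3 * x1^2 + 2 * a2 * x1 + a4 - a1 * y1) / (2 * y1 + a1 * x1 + a3)
                 else (y2 - y1) / (x2 - x1));
            n = y1 - m * x1;
            x3 = m^2 + a1 * m - a2 - x1 - x2
        in Affine x3 (- (m + a1) * x3 - n - a3))"


section \<open>Curves with a group law and a Kummer map\<close>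

record ('p, 'q) kummer_curve = "'p monoid" +
  kummer :: "'p \<Rightarrow> 'q"

definition Delta :: "('p, 'q) kummer_curve \<Rightarrow> 'p \<Rightarrow> ('p \<times> 'p) set" where
  "Delta G P = {(Q, R). Q \<in> carrier G \<and> R \<in> carrier G \<and> Q \<otimes>\<^bsub>G\<^esub> inv\<^bsub>G\<^esub> R = P}"

definition montgomery :: "('p, 'q) kummer_curve \<Rightarrow> 'p \<times> 'p \<Rightarrow> 'p \<times> 'p" where
  "montgomery G = (\<lambda>(Q, R). (Q \<otimes>\<^bsub>G\<^esub> Q, Q \<otimes>\<^bsub>G\<^esub> R))"

definition kummer2 :: "('p, 'q) kummer_curve \<Rightarrow> 'p \<times> 'p \<Rightarrow> 'q \<times> 'q" where
  "kummer2 G = map_prod (kummer G) (kummer G)"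

definition kummer_Delta :: "('p, 'q) kummer_curve \<Rightarrow> 'p \<Rightarrow> ('q \<times> 'q) set" where
  "kummer_Delta G P = kummer2 G ` Delta G P"

definition kummer_montgomery ::
    "('p, 'q) kummer_curve \<Rightarrow> 'p \<Rightarrow> 'q \<times> 'q \<Rightarrow> 'q \<times> 'q" where
  "kummer_montgomery G P z =
     (THE w. \<exists>D \<in> Delta G P. kummer2 G D = z \<and> kummer2 G (montgomery G D) = w)"


section \<open>The Z/4Z-normal form with parameter \<open>c\<^sup>2\<close>\<close>

definition Z4_eqn :: "'k::field \<Rightarrow> 'k \<times> 'k \<times> 'k \<times> 'k \<Rightarrow> bool" where
  "Z4_eqn c = (\<lambda>(x0, x1, x2, x3).
     (x0 + x1 + x2 + x3)^2 = c^2 * x0 * x2 \<and> c^2 * x0 * x2 = c^2 * x1 * x3)"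

definition Z4_points :: "'k::field \<Rightarrow> 'k P3 set" where
  "Z4_points c = proj3 ` {v. v \<noteq> (0, 0, 0, 0) \<and> Z4_eqn c v}"

text \<open>
  Jacobian criterion, for \<open>c\<close> in an algebraically closed field: the gradients of the two quadrics
  \<open>s\<^sup>2 - c\<^sup>2 x0 x2\<close> and \<open>s\<^sup>2 - c\<^sup>2 x1 x3\<close>, where \<open>s = x0 + x1 + x2 + x3\<close>, are independent at every
  point of their intersection.  A smooth intersection of two quadrics in projective 3-space is a
  curve of genus one, so this says that the Z/4Z-normal form is an elliptic curve.
\<close>

definition Z4_elliptic :: "'k::alg_closed_field \<Rightarrow> bool" where
  "Z4_elliptic c \<longleftrightarrow> (\<forall>x0 x1 x2 x3 a b.
     (x0, x1, x2, x3) \<noteq> (0, 0, 0, 0) \<and> Z4_eqn c (x0, x1, x2, x3) \<and>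
     (let s = x0 + x1 + x2 + x3 in
        a * (2 * s - c^2 * x2) + b * (2 * s) = 0 \<and>
        a * (2 * s) + b * (2 * s - c^2 * x3) = 0 \<and>
        a * (2 * s - c^2 * x0) + b * (2 * s) = 0 \<and>
        a * (2 * s) + b * (2 * s - c^2 * x1) = 0)
     \<longrightarrow> a = 0 \<and> b = 0)"

text \<open>
  Linear projection from \<open>(0:1:1:0)\<close> maps the curve isomorphically onto the plane cubic
  \<open>c\<^sup>2 a (a + d) u = d (d + u)\<^sup>2\<close>, where \<open>a = x0\<close>, \<open>d = x0 + x3\<close>, \<open>u = x1 + x2\<close>, and maps
  \<open>(1:0:0:1)\<close> to the flex \<open>u = d = 0\<close>.  In the coordinates \<open>x = d / (c\<^sup>2 u)\<close> and \<open>y = a / (c\<^sup>2 u)\<close>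
  this cubic is \<open>y\<^sup>2 + x y = x\<^sup>3 + x / c\<^sup>4\<close>.  On the curve \<open>u = 0\<close> holds only at \<open>(1:0:0:1)\<close> and at
  the centre of projection; the centre corresponds to the point \<open>(0, 0)\<close>.

  Since \<open>x0 x2 = x1 x3\<close>, the Kummer coordinate \<open>(u0:u1) = (x0:x1)\<close> is \<open>(c\<^sup>2 x : 1)\<close>.  Doubling on
  \<open>y\<^sup>2 + x y = x\<^sup>3 + x / c\<^sup>4\<close> is \<open>x \<mapsto> x\<^sup>2 + 1 / (c\<^sup>8 x\<^sup>2)\<close>, which is
  \<open>(u0:u1) \<mapsto> (u0\<^sup>4 + u1\<^sup>4 : c\<^sup>2 u0\<^sup>2 u1\<^sup>2)\<close>: the coefficient is the curve parameter \<open>c\<^sup>2\<close>, not \<open>c\<close>.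
\<close>

definition Z4_weierstrass :: "'k::field \<Rightarrow> 'k \<times> 'k \<times> 'k \<times> 'k \<times> 'k" where
  "Z4_weierstrass c = (1, 0, 0, 1 / c^4, 0)"

definition Z4_to_weierstrass :: "'k::field \<Rightarrow> 'k P3 \<Rightarrow> 'k wpoint" where
  "Z4_to_weierstrass c Q = (case coords Q of (x0, x1, x2, x3) \<Rightarrow>
     if x1 + x2 \<noteq> 0 then Affine ((x0 + x3) / (c^2 * (x1 + x2))) (x0 / (c^2 * (x1 + x2)))
     else if x0 \<noteq> 0 then At_Infinity
     else Affine 0 0)"

definition Z4_kummer :: "'k::field P3 \<Rightarrow> 'k P1" where
  "Z4_kummer Q = (case coords Q of (x0, x1, x2, x3) \<Rightarrow>
     if (x0, x1) \<noteq> (0, 0) then proj1 (x0, x1) else proj1 (x3, x2))"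

text \<open>
  The group law of an elliptic curve is carried over from the chord-tangent law along an
  isomorphism to a Weierstrass curve that respects the identities.
\<close>

definition Z4_curve :: "'k::field \<Rightarrow> ('k P3, 'k P1) kummer_curve" where
  "Z4_curve c = \<lparr>
     carrier = Z4_points c,
     monoid.mult = (\<lambda>Q R. inv_into (Z4_points c) (Z4_to_weierstrass c)
       (weierstrass_add (Z4_weierstrass c) (Z4_to_weierstrass c Q) (Z4_to_weierstrass c R))),
     one = proj3 (1, 0, 0, 1),
     kummer = Z4_kummer\<rparr>"


section \<open>The split \<open>\<mu>\<^sub>4\<close>-normal form\<close>

definition mu4_eqn :: "'k::field \<Rightarrow> 'k \<times> 'k \<times> 'k \<times> 'k \<Rightarrow> bool" where
  "mu4_eqn c = (\<lambda>(x0, x1, x2, x3).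
     (x0 + x2)^2 = c^2 * x1 * x3 \<and> (x1 + x3)^2 = c^2 * x0 * x2)"

definition mu4_points :: "'k::field \<Rightarrow> 'k P3 set" where
  "mu4_points c = proj3 ` {v. v \<noteq> (0, 0, 0, 0) \<and> mu4_eqn c v}"

text \<open>
  The Z/4Z-normal form lies on the quadric \<open>x0 x2 = x1 x3\<close>, the Segre image
  \<open>(u0 w0 : u1 w0 : u1 w1 : u0 w1)\<close> of a product of two projective lines.  The isomorphism is
  \<open>(u0:u1) = (c x0 : x1 + x3) = (x1 + x3 : c x2)\<close> and
  \<open>(w0:w1) = (x0 + x2 : c x3) = (c x1 : x0 + x2)\<close>.
\<close>

definition mu4_to_Z4 :: "'k::field \<Rightarrow> 'k P3 \<Rightarrow> 'k P3" where
  "mu4_to_Z4 c S = (case coords S of (x0, x1, x2, x3) \<Rightarrow>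
     let (u0, u1) = (if (c * x0, x1 + x3) \<noteq> (0, 0) then (c * x0, x1 + x3) else (x1 + x3, c * x2));
         (w0, w1) = (if (x0 + x2, c * x3) \<noteq> (0, 0) then (x0 + x2, c * x3) else (c * x1, x0 + x2))
     in proj3 (u0 * w0, u1 * w0, u1 * w1, u0 * w1))"

definition mu4_kummer :: "'k::field \<Rightarrow> 'k P3 \<Rightarrow> 'k P1" where
  "mu4_kummer c S = (case coords S of (x0, x1, x2, x3) \<Rightarrow>
     if (c * x0, x1 + x3) \<noteq> (0, 0) then proj1 (c * x0, x1 + x3) else proj1 (x1 + x3, c * x2))"

definition mu4_curve :: "'k::field \<Rightarrow> ('k P3, 'k P1) kummer_curve" where
  "mu4_curve c = \<lparr>
     carrier = mu4_points c,
     monoid.mult = (\<lambda>S T. inv_into (mu4_points c) (mu4_to_Z4 c)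
       (mu4_to_Z4 c S \<otimes>\<^bsub>Z4_curve c\<^esub> mu4_to_Z4 c T)),
     one = proj3 (c, 1, 0, 1),
     kummer = mu4_kummer c\<rparr>"


section \<open>Bijectivity of the two isomorphisms, and smoothness, in characteristic two\<close>

lemma coords_proj3:
  "\<exists>l. l \<noteq> 0 \<and> coords (proj3 (x0, x1, x2, x3)) = (l * x0, l * x1, l * x2, l * x3)"
proof -
  have "(x0, x1, x2, x3) \<in> proj3 (x0, x1, x2, x3)"
    unfolding proj3_def by (auto intro!: exI[of _ 1])
  then have "coords (proj3 (x0, x1, x2, x3)) \<in> proj3 (x0, x1, x2, x3)"
    unfolding coords_def by (rule someI)
  then show ?thesis by (auto simp: proj3_def)
qed

lemma proj3_scale:
  assumes "l \<noteq> 0"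
  shows "proj3 (l * x0, l * x1, l * x2, l * x3) = proj3 (x0, x1, x2, x3)"
proof -
  have "\<exists>n. n \<noteq> 0 \<and> (m * x0, m * x1, m * x2, m * x3) = (n * (l * x0), n * (l * x1), n * (l * x2), n * (l * x3))"
    if "m \<noteq> 0" for m
    using assms that by (intro exI[of _ "m / l"]) simp
  moreover have "\<exists>n. n \<noteq> 0 \<and> (m * (l * x0), m * (l * x1), m * (l * x2), m * (l * x3)) = (n * x0, n * x1, n * x2, n * x3)"
    if "m \<noteq> 0" for m
    using assms that by (intro exI[of _ "m * l"]) simp
  ultimately show ?thesis
    unfolding proj3_def by (simp only: case_prod_conv set_eq_iff mem_Collect_eq) metis
qed

lemma proj1_scale:
  assumes "l \<noteq> 0"
  shows "proj1 (l * x0, l * x1) = proj1 (x0, x1)"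
proof -
  have "\<exists>n. n \<noteq> 0 \<and> (m * x0, m * x1) = (n * (l * x0), n * (l * x1))" if "m \<noteq> 0" for m
    using assms that by (intro exI[of _ "m / l"]) simp
  moreover have "\<exists>n. n \<noteq> 0 \<and> (m * (l * x0), m * (l * x1)) = (n * x0, n * x1)" if "m \<noteq> 0" for m
    using assms that by (intro exI[of _ "m * l"]) simp
  ultimately show ?thesis
    unfolding proj1_def by (simp only: case_prod_conv set_eq_iff mem_Collect_eq) metis
qed

lemma Z4_to_weierstrass_proj3:
  "Z4_to_weierstrass c (proj3 (x0, x1, x2, x3)) =
     (if x1 + x2 \<noteq> 0 then Affine ((x0 + x3) / (c^2 * (x1 + x2))) (x0 / (c^2 * (x1 + x2)))
      else if x0 \<noteq> 0 then At_Infinity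
      else Affine 0 0)"
proof -
  obtain l where l: "l \<noteq> 0" "coords (proj3 (x0, x1, x2, x3)) = (l * x0, l * x1, l * x2, l * x3)"
    using coords_proj3 by blast
  have "l * x1 + l * x2 = l * (x1 + x2)" "l * x0 + l * x3 = l * (x0 + x3)"
    by (simp_all add: distrib_left)
  with l show ?thesis
    by (simp add: Z4_to_weierstrass_def mult.left_commute[of _ l])
qed

lemma Z4_kummer_proj3:
  "Z4_kummer (proj3 (x0, x1, x2, x3)) =
     (if (x0, x1) \<noteq> (0, 0) then proj1 (x0, x1) else proj1 (x3, x2))"
proof -
  obtain l where l: "l \<noteq> 0" "coords (proj3 (x0, x1, x2, x3)) = (l * x0, l * x1, l * x2, l * x3)"
    using coords_proj3 by blast
  then show ?thesis
    by (simp add: Z4_kummer_def proj1_scale)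
qed

lemma mu4_kummer_proj3:
  "mu4_kummer c (proj3 (x0, x1, x2, x3)) =
     (if (c * x0, x1 + x3) \<noteq> (0, 0) then proj1 (c * x0, x1 + x3) else proj1 (x1 + x3, c * x2))"
proof -
  obtain l where l: "l \<noteq> 0" "coords (proj3 (x0, x1, x2, x3)) = (l * x0, l * x1, l * x2, l * x3)"
    using coords_proj3 by blast
  have *: "l * x1 + l * x3 = l * (x1 + x3)" "c * (l * x) = l * (c * x)" for x
    by (simp_all add: distrib_left)
  have "(l * a, l * b) \<noteq> (0, 0) \<longleftrightarrow> (a, b) \<noteq> (0, 0)" for a b
    using l(1) by auto
  then show ?thesis
    unfolding mu4_kummer_def l(2) prod.case * by (simp only: proj1_scale[OF l(1)])
qed

lemma mu4_to_Z4_proj3: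
  "mu4_to_Z4 c (proj3 (x0, x1, x2, x3)) =
     (let (u0, u1) = (if (c * x0, x1 + x3) \<noteq> (0, 0) then (c * x0, x1 + x3) else (x1 + x3, c * x2));
          (w0, w1) = (if (x0 + x2, c * x3) \<noteq> (0, 0) then (x0 + x2, c * x3) else (c * x1, x0 + x2))
      in proj3 (u0 * w0, u1 * w0, u1 * w1, u0 * w1))"
proof -
  obtain l where l: "l \<noteq> 0" "coords (proj3 (x0, x1, x2, x3)) = (l * x0, l * x1, l * x2, l * x3)"
    using coords_proj3 by blast
  have *: "l * x1 + l * x3 = l * (x1 + x3)" "l * x0 + l * x2 = l * (x0 + x2)"
    "c * (l * x) = l * (c * x)" for x
    by (simp_all add: distrib_left)
  have **: "(l * a) * (l * b) = l\<^sup>2 * (a * b)" for a b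
    by (simp add: power2_eq_square)
  have ***: "(l * a, l * b) \<noteq> (0, 0) \<longleftrightarrow> (a, b) \<noteq> (0, 0)" for a b
    using l(1) by auto
  from l have "l\<^sup>2 \<noteq> 0" by simp
  note sc = proj3_scale[OF this]
  show ?thesis
    unfolding mu4_to_Z4_def l(2) prod.case * *** Let_def
    by (cases "(c * x0, x1 + x3) \<noteq> (0, 0)"; cases "(x0 + x2, c * x3) \<noteq> (0, 0)";
        simp only: if_True if_False not_False_eq_True prod.case ** sc)
qed

context
  assumes char2: "CHAR('k::field) = 2"
begin

lemma two0: "(2::'k) = 0"
  using of_nat_CHAR[where 'a = 'k] char2 by simp

lemma dbl0: "x + x = (0::'k)"
  using two0 by (metis mult_2 mult_zero_left)

lemma neg_id: "- x = (x::'k)"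
  using dbl0 by (metis add_eq_0_iff)

lemma sub_add: "x - y = x + (y::'k)"
  using neg_id by (metis diff_conv_add_uminus)

lemma sq_add: "(x + y)^2 = x^2 + (y::'k)^2"
  by (simp add: power2_sum two0)

lemma add0_iff: "x + y = 0 \<longleftrightarrow> x = (y::'k)"
  using neg_id by (metis add_eq_0_iff)

lemma dbl0': "x + (x + y) = (y::'k)"
  by (simp add: dbl0 flip: add.assoc)

lemmas char2_simps = dbl0 dbl0' neg_id sub_add sq_add two0

lemma Z4_eqn_iff: "Z4_eqn c (x0, x1, x2, x3::'k) \<longleftrightarrow>
    (x0 + x1 + x2 + x3)^2 = c^2 * x0 * x2 \<and> (x0 + x1 + x2 + x3)^2 = c^2 * x1 * x3"
  by (auto simp: Z4_eqn_def)

lemma Z4_pointsE: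
  assumes "Q \<in> Z4_points (c::'k)"
  obtains x0 x1 x2 x3 where "Q = proj3 (x0, x1, x2, x3)" "(x0, x1, x2, x3) \<noteq> (0, 0, 0, 0)"
    "(x0 + x1 + x2 + x3)^2 = c^2 * x0 * x2" "(x0 + x1 + x2 + x3)^2 = c^2 * x1 * x3"
proof -
  from assms obtain v where "Q = proj3 v" "v \<noteq> (0, 0, 0, 0)" "Z4_eqn c v"
    by (auto simp: Z4_points_def)
  moreover obtain x0 x1 x2 x3 where "v = (x0, x1, x2, x3)" by (cases v)
  ultimately show ?thesis using that[of x0 x1 x2 x3] Z4_eqn_iff by blast
qed

lemma Z4_on_weierstrass:
  assumes c: "(c::'k) \<noteq> 0" and Q: "Q \<in> Z4_points c"
  shows "Z4_to_weierstrass c Q \<in> on_weierstrass (Z4_weierstrass c)"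
proof -
  obtain x0 x1 x2 x3 where Q: "Q = proj3 (x0, x1, x2, x3)"
    and "(x0, x1, x2, x3) \<noteq> (0, 0, 0, 0)"
    and e1: "(x0 + x1 + x2 + x3)^2 = c^2 * x0 * x2"
    and e2: "(x0 + x1 + x2 + x3)^2 = c^2 * x1 * x3"
    using Q by (rule Z4_pointsE)
  define u where "u = x1 + x2"
  define d where "d = x0 + x3"
  have s: "x0 + x1 + x2 + x3 = d + u" by (simp add: u_def d_def ac_simps)
  have x3: "x3 = x0 + d" by (simp add: d_def dbl0')
  have "d * (d + u)^2 = c^2 * (x0 * (x1 * x3)) + c^2 * (x3 * (x0 * x2))"
    using e1 e2 unfolding s by (simp add: d_def algebra_simps)
  also have "\<dots> = c^2 * x0 * x3 * u"
    by (simp add: u_def algebra_simps)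
  finally have cub: "d * (d + u)^2 = c^2 * x0 * (x0 + d) * u"
    unfolding x3 .
  show ?thesis
  proof (cases "u = 0")
    case False
    have "(x0 / (c^2 * u))^2 + d / (c^2 * u) * (x0 / (c^2 * u)) =
          (c^2 * x0 * (x0 + d) * u) / (c^6 * u^3)"
      using c False by (simp add: field_simps) (simp add: eval_nat_numeral algebra_simps)
    also have "\<dots> = d * (d + u)^2 / (c^6 * u^3)"
      by (simp only: cub)
    also have "\<dots> = (d / (c^2 * u))^3 + 1 / c^4 * (d / (c^2 * u))"
      using c False by (simp add: field_simps sq_add) (simp add: eval_nat_numeral algebra_simps)
    finally show ?thesis
      using False unfolding Q Z4_to_weierstrass_proj3 on_weierstrass_def Z4_weierstrass_def
      by (simp flip: u_def d_def)
  qed (simp_all add: Q Z4_to_weierstrass_proj3 on_weierstrass_def Z4_weierstrass_def flip: u_def)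
qed

lemma Z4_to_weierstrass_inj:
  assumes c: "(c::'k) \<noteq> 0"
  shows "inj_on (Z4_to_weierstrass c) (Z4_points c)"
proof (rule inj_onI)
  fix Q R assume Q: "Q \<in> Z4_points c" and R: "R \<in> Z4_points c"
    and eq: "Z4_to_weierstrass c Q = Z4_to_weierstrass c R"
  have norm: "\<exists>x0 x1 x2 x3. Q = proj3 (x0, x1, x2, x3) \<and> Z4_eqn c (x0, x1, x2, x3) \<and>
      (x1 + x2 = 1 \<or> (x0, x1, x2, x3) = (1,0,0,1) \<or> (x0, x1, x2, x3) = (0,1,1,0))"
    if "Q \<in> Z4_points c" for Q
  proof -
    from that obtain x0 x1 x2 x3 where Q: "Q = proj3 (x0, x1, x2, x3)"
      and nz: "(x0, x1, x2, x3) \<noteq> (0, 0, 0, 0)"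
      and e1: "(x0 + x1 + x2 + x3)^2 = c^2 * x0 * x2"
      and e2: "(x0 + x1 + x2 + x3)^2 = c^2 * x1 * x3"
      by (rule Z4_pointsE)
    show ?thesis
    proof (cases "x1 + x2 = 0")
      case True
      then have x21: "x2 = x1" by (simp add: add0_iff)
      have "c^2 * x1 * (x0 + x3) = c^2 * x0 * x2 + c^2 * x1 * x3"
        unfolding x21 by (simp add: algebra_simps)
      also have "\<dots> = 0"
        unfolding e1[symmetric] e2[symmetric] by (rule dbl0)
      finally have "c^2 * x1 * (x0 + x3) = 0" .
      moreover have "x0 + x1 + x2 + x3 = x0 + x3"
        using x21 by (simp add: ac_simps char2_simps)
      ultimately have "x0 = x3 \<and> (x1 = 0 \<or> x0 = 0)"
        using e1 c x21 add0_iff by (auto simp: add0_iff)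
      then consider "x0 = x3" "x1 = 0" "x0 \<noteq> 0" | "x0 = 0" "x3 = 0" "x1 \<noteq> 0"
        using nz x21 by auto
      then show ?thesis
      proof cases
        case 1
        have "Q = proj3 (1, 0, 0, 1)"
          using proj3_scale[of x0 1 0 0 1] 1 x21 Q by simp
        then show ?thesis using 1 by (intro exI[of _ 1] exI[of _ 0]) (auto simp: Z4_eqn_iff dbl0)
      next
        case 2
        have "Q = proj3 (0, 1, 1, 0)"
          using proj3_scale[of x1 0 1 1 0] 2 x21 Q by simp
        then show ?thesis
          by (intro exI[of _ 0] exI[of _ 1]) (auto simp: Z4_eqn_iff char2_simps)
      qed
    next
      case False
      define l where "l = 1 / (x1 + x2)"
      have l: "l \<noteq> 0" using False by (simp add: l_def)
      have "Q = proj3 (l * x0, l * x1, l * x2, l * x3)" and "l * x1 + l * x2 = 1"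
        using proj3_scale[OF l] Q False by (simp_all add: l_def flip: add_divide_distrib)
      note 1 = this
      have "l * x0 + l * x1 + l * x2 + l * x3 = l * (x0 + x1 + x2 + x3)"
        by (simp add: algebra_simps)
      moreover have "(l * (x0 + x1 + x2 + x3))^2 = c^2 * (l * x0) * (l * x2)"
        unfolding power_mult_distrib e1 by (simp add: power2_eq_square)
      moreover have "(l * (x0 + x1 + x2 + x3))^2 = c^2 * (l * x1) * (l * x3)"
        unfolding power_mult_distrib e2 by (simp add: power2_eq_square)
      ultimately have "Z4_eqn c (l * x0, l * x1, l * x2, l * x3)"
        unfolding Z4_eqn_iff by simp
      with 1 show ?thesis by blast
    qed
  qed
  from norm[OF Q] obtain x0 x1 x2 x3 where x: "Q = proj3 (x0, x1, x2, x3)"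
    "Z4_eqn c (x0, x1, x2, x3)"
    "x1 + x2 = 1 \<or> (x0, x1, x2, x3) = (1,0,0,1) \<or> (x0, x1, x2, x3) = (0,1,1,0)" by blast
  from norm[OF R] obtain y0 y1 y2 y3 where y: "R = proj3 (y0, y1, y2, y3)"
    "Z4_eqn c (y0, y1, y2, y3)"
    "y1 + y2 = 1 \<or> (y0, y1, y2, y3) = (1,0,0,1) \<or> (y0, y1, y2, y3) = (0,1,1,0)" by blast
  have key: "\<not> (z0 = 0 \<and> z3 = 0)" if "z1 + z2 = 1" "Z4_eqn c (z0, z1, z2, z3)" for z0 z1 z2 z3
    using that by (auto simp: Z4_eqn_iff)
  have key': "x1 = y1 \<and> x2 = y2" if "x1 + x2 = 1" "y1 + y2 = 1" "y0 = x0" "y3 = x3"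
  proof -
    have s: "x0 + x1 + x2 + x3 = y0 + y1 + y2 + y3"
      using that by (metis add.assoc)
    have x2: "x2 = x1 + 1" "y2 = y1 + 1"
      using that by (metis dbl0')+
    have "c^2 * x0 * x2 = c^2 * x0 * y2" "c^2 * x1 * x3 = c^2 * y1 * x3"
      using x(2)[unfolded Z4_eqn_iff s] y(2)[unfolded Z4_eqn_iff] unfolding that(3,4) by metis+
    then have "x0 = 0 \<or> x2 = y2" "x3 = 0 \<or> x1 = y1"
      using c by auto
    with key[OF that(1) x(2)] x2 show ?thesis by auto
  qed
  show "Q = R"
    using x(3) y(3)
  proof (elim disjE)
    assume a: "x1 + x2 = 1" "y1 + y2 = 1"
    with eq c have "x0 + x3 = y0 + y3 \<and> x0 = y0"
      by (auto simp: x(1) y(1) Z4_to_weierstrass_proj3)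
    then have "y0 = x0" "y3 = x3" by auto
    with a key' show ?thesis by (simp add: x(1) y(1))
  qed (use eq c key[OF _ x(2)] key[OF _ y(2)] in
      \<open>auto simp: x(1) y(1) Z4_to_weierstrass_proj3 char2_simps add0_iff\<close>)
qed

lemma Z4_to_weierstrass_surj:
  assumes c: "(c::'k) \<noteq> 0" and p: "p \<in> on_weierstrass (Z4_weierstrass c)"
  shows "p \<in> Z4_to_weierstrass c ` Z4_points c"
proof (cases p)
  case At_Infinity
  have "proj3 (1, 0, 0, 1) \<in> Z4_points c"
    unfolding Z4_points_def by (rule imageI) (simp add: Z4_eqn_iff dbl0)
  then show ?thesis
    by (rule rev_image_eqI) (simp add: At_Infinity Z4_to_weierstrass_proj3)
next
  case (Affine x y)
  with p have "y^2 + x * y = x^3 + 1 / c^4 * x"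
    by (simp add: on_weierstrass_def Z4_weierstrass_def)
  then have "c^6 * (y^2 + x * y) = c^6 * (x^3 + 1 / c^4 * x)" by simp
  moreover define a d where "a = c^2 * y" and "d = c^2 * x"
  have "c^6 * (y^2 + x * y) = c^2 * a * (a + d)"
    by (simp add: a_def d_def eval_nat_numeral algebra_simps)
  moreover have "c^6 * (x^3 + 1 / c^4 * x) = d * (d^2 + 1)"
    using c by (simp add: a_def d_def distrib_left) (simp add: eval_nat_numeral)
  ultimately have cub: "c^2 * a * (a + d) = d * (d^2 + 1)" by simp
  have cub': "c^2 * a * (a + d) = d * (d + 1)^2" unfolding cub by (simp add: sq_add)
  define b where "b = a + d"
  have d: "d = a + b" by (simp add: b_def dbl0')
  have *: "p = Affine ((a + b) / (c^2 * 1)) (a / (c^2 * 1))"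
    using c unfolding d[symmetric] by (simp add: Affine a_def d_def)
  have "\<exists>x1 x2. (x1 + x2 = 1 \<and> Z4_eqn c (a, x1, x2, b)) \<or> (a = 0 \<and> b = 0)"
  proof -
    consider "a = 0" "b = 0" | "a = 0" "b \<noteq> 0" | "a \<noteq> 0" "b = 0" | "a \<noteq> 0" "b \<noteq> 0" by blast
    then show ?thesis
    proof cases
      case 2
      then have "d = 1" using cub' d by (simp add: add0_iff)
      with 2 d have "b = 1" by simp
      with 2 have "Z4_eqn c (a, 0, 1, b)" by (simp add: Z4_eqn_iff dbl0)
      then show ?thesis by (intro exI[of _ 0] exI[of _ 1]) simp
    next
      case 3
      then have "d = a" using d by simp
      with cub' 3 have "a = 1" by (simp add: dbl0 add0_iff)
      with 3 have "Z4_eqn c (a, 1, 0, b)" by (simp add: Z4_eqn_iff dbl0)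
      then show ?thesis by (intro exI[of _ 1] exI[of _ 0]) simp
    next
      case 4
      let ?s = "(d + 1)^2"
      have cb: "c^2 * a * b = (a + b) * ?s" using cub'[folded b_def] unfolding d[symmetric] .
      have "?s / (c^2 * b) + ?s / (c^2 * a) = (a + b) * ?s / (c^2 * a * b)"
        using 4 c by (simp add: field_simps)
      also have "\<dots> = 1" using 4 c by (simp add: cb[symmetric])
      finally have s1: "?s / (c^2 * b) + ?s / (c^2 * a) = 1" .
      have "a + ?s / (c^2 * b) + ?s / (c^2 * a) + b = d + (?s / (c^2 * b) + ?s / (c^2 * a))"
        by (simp only: d ac_simps)
      then have "a + ?s / (c^2 * b) + ?s / (c^2 * a) + b = d + 1" unfolding s1 .
      then have "Z4_eqn c (a, ?s / (c^2 * b), ?s / (c^2 * a), b)"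
        using 4 c by (simp add: Z4_eqn_iff)
      with s1 show ?thesis by blast
    qed auto
  qed
  then consider x1 x2 where "x1 + x2 = 1" "Z4_eqn c (a, x1, x2, b)" | "a = 0" "b = 0" by blast
  then show ?thesis
  proof cases
    case 1
    then have "proj3 (a, x1, x2, b) \<in> Z4_points c"
      unfolding Z4_points_def by (intro imageI) auto
    then show ?thesis
      by (rule rev_image_eqI) (simp add: * Z4_to_weierstrass_proj3 1)
  next
    case 2
    have "proj3 (0, 1, 1, 0) \<in> Z4_points c"
      unfolding Z4_points_def by (rule imageI) (simp add: Z4_eqn_iff dbl0)
    then show ?thesis
      by (rule rev_image_eqI) (simp add: * 2 Z4_to_weierstrass_proj3 dbl0)
  qed
qed

lemma Z4_to_weierstrass_bij:
  "(c::'k) \<noteq> 0 \<Longrightarrow>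
     bij_betw (Z4_to_weierstrass c) (Z4_points c) (on_weierstrass (Z4_weierstrass c))"
  unfolding bij_betw_def
  using Z4_to_weierstrass_inj Z4_on_weierstrass Z4_to_weierstrass_surj by blast

lemma proj3_eqD:
  assumes "proj3 (x0, x1, x2, x3) = proj3 (y0, y1, y2, y3)"
  shows "\<exists>l. l \<noteq> 0 \<and> x0 = l * y0 \<and> x1 = l * y1 \<and> x2 = l * y2 \<and> x3 = l * y3"
proof -
  have "(x0, x1, x2, x3) \<in> proj3 (x0, x1, x2, x3)"
    unfolding proj3_def by (auto intro!: exI[of _ 1])
  then have "(x0, x1, x2, x3) \<in> proj3 (y0, y1, y2, y3)" unfolding assms .
  then show ?thesis by (auto simp: proj3_def)
qed

definition mu4_rel :: "'k \<Rightarrow> 'k \<Rightarrow> 'k \<Rightarrow> 'k \<Rightarrow> 'k \<Rightarrow> 'k \<Rightarrow> 'k \<Rightarrow> bool" where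
  "mu4_rel c m n u0 u1 w0 w1 \<longleftrightarrow> m \<noteq> 0 \<and> n \<noteq> 0 \<and> (u0 \<noteq> 0 \<or> u1 \<noteq> 0) \<and> (w0 \<noteq> 0 \<or> w1 \<noteq> 0) \<and>
     m * (u0 + u1)^2 = c * n * w0 * w1 \<and> n * (w0 + w1)^2 = c * m * u0 * u1"

lemma mu4_rel_points:
  assumes c: "c \<noteq> 0" and rel: "mu4_rel c m n u0 u1 w0 w1"
  shows "proj3 (m * u0^2, n * w0^2, m * u1^2, n * w1^2) \<in> mu4_points c"
    and "mu4_to_Z4 c (proj3 (m * u0^2, n * w0^2, m * u1^2, n * w1^2)) =
           proj3 (u0 * w0, u1 * w0, u1 * w1, u0 * w1)"
    and "proj3 (u0 * w0, u1 * w0, u1 * w1, u0 * w1) \<in> Z4_points c"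
proof -
  have nz: "m \<noteq> 0" "n \<noteq> 0" "u0 \<noteq> 0 \<or> u1 \<noteq> 0" "w0 \<noteq> 0 \<or> w1 \<noteq> 0"
    and e: "m * (u0 + u1)^2 = c * n * w0 * w1" "n * (w0 + w1)^2 = c * m * u0 * u1"
    using rel by (auto simp: mu4_rel_def)
  have A: "m * u0^2 + m * u1^2 = c * n * w0 * w1" and B: "n * w0^2 + n * w1^2 = c * m * u0 * u1"
    using e by (simp_all add: sq_add distrib_left)
  have "mu4_eqn c (m * u0^2, n * w0^2, m * u1^2, n * w1^2)"
    unfolding mu4_eqn_def prod.case A B by (simp add: power2_eq_square)
  then show "proj3 (m * u0^2, n * w0^2, m * u1^2, n * w1^2) \<in> mu4_points c"
    unfolding mu4_points_def by (intro imageI) (use nz in auto)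
  have U: "(if (c * (m * u0^2), c * m * u0 * u1) \<noteq> (0, 0) then (c * (m * u0^2), c * m * u0 * u1)
      else (c * m * u0 * u1, c * (m * u1^2))) =
      (let l = (if u0 \<noteq> 0 then c * m * u0 else c * m * u1) in (l * u0, l * u1))"
    using c nz by (auto simp: power2_eq_square Let_def)
  have W: "(if (c * n * w0 * w1, c * (n * w1^2)) \<noteq> (0, 0) then (c * n * w0 * w1, c * (n * w1^2))
      else (c * (n * w0^2), c * n * w0 * w1)) =
      (let l = (if w1 \<noteq> 0 then c * n * w1 else c * n * w0) in (l * w0, l * w1))"
    using c nz by (auto simp: power2_eq_square Let_def)
  define a where "a = (if u0 \<noteq> 0 then c * m * u0 else c * m * u1)"
  define b where "b = (if w1 \<noteq> 0 then c * n * w1 else c * n * w0)"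
  have ab: "a * b \<noteq> 0" using c nz by (auto simp: a_def b_def)
  have m4: "(a * x) * (b * y) = a * b * (x * y)" for x y by simp
  show "mu4_to_Z4 c (proj3 (m * u0^2, n * w0^2, m * u1^2, n * w1^2)) =
      proj3 (u0 * w0, u1 * w0, u1 * w1, u0 * w1)"
    unfolding mu4_to_Z4_proj3 A B U W Let_def a_def[symmetric] b_def[symmetric] prod.case m4
    by (rule proj3_scale[OF ab])
  have "(u0 + u1)^2 * (w0 + w1)^2 * (m * n) = (m * (u0 + u1)^2) * (n * (w0 + w1)^2)"
    by simp
  also have "\<dots> = c^2 * u0 * u1 * w0 * w1 * (m * n)"
    unfolding e by (simp add: power2_eq_square)
  finally have "(u0 + u1)^2 * (w0 + w1)^2 = c^2 * u0 * u1 * w0 * w1" using nz by simp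
  moreover have "u0 * w0 + u1 * w0 + u1 * w1 + u0 * w1 = (u0 + u1) * (w0 + w1)"
    by (simp add: algebra_simps)
  ultimately have "Z4_eqn c (u0 * w0, u1 * w0, u1 * w1, u0 * w1)"
    by (simp add: Z4_eqn_iff power_mult_distrib)
  then show "proj3 (u0 * w0, u1 * w0, u1 * w1, u0 * w1) \<in> Z4_points c"
    unfolding Z4_points_def by (intro imageI) (use nz in auto)
qed

lemma mu4_param:
  assumes c: "c \<noteq> 0" and S: "S \<in> mu4_points c"
  obtains m n u0 u1 w0 w1 where "mu4_rel c m n u0 u1 w0 w1"
    "S = proj3 (m * u0^2, n * w0^2, m * u1^2, n * w1^2)"
proof -
  from S obtain v where v: "S = proj3 v" "v \<noteq> (0, 0, 0, 0)" "mu4_eqn c v"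
    by (auto simp: mu4_points_def)
  obtain x0 x1 x2 x3 where x: "v = (x0, x1, x2, x3)" by (cases v)
  have e1: "(x0 + x2)^2 = c^2 * x1 * x3" and e2: "(x1 + x3)^2 = c^2 * x0 * x2"
    using v(3) by (simp_all add: x mu4_eqn_def)
  have U: "\<exists>m u0 u1. m \<noteq> 0 \<and> (u0 \<noteq> 0 \<or> u1 \<noteq> 0) \<and> x0 = m * u0^2 \<and> x2 = m * u1^2 \<and>
      x1 + x3 = c * m * u0 * u1"
  proof (cases "x0 = 0")
    case True
    then have "x1 + x3 = 0" using e2 by simp
    moreover have "x2 \<noteq> 0"
    proof
      assume "x2 = 0"
      with True e1 c \<open>x1 + x3 = 0\<close> have "x1 = 0 \<and> x3 = 0" by (auto simp: add0_iff)
      with v(2) x True \<open>x2 = 0\<close> show False by simp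
    qed
    ultimately show ?thesis
      using True by (intro exI[of _ x2] exI[of _ 0] exI[of _ 1]) simp
  next
    case False
    with c e2 show ?thesis
      by (intro exI[of _ "1 / (c^2 * x0)"] exI[of _ "c * x0"] exI[of _ "x1 + x3"])
        (simp add: field_simps power2_eq_square)
  qed
  have W: "\<exists>n w0 w1. n \<noteq> 0 \<and> (w0 \<noteq> 0 \<or> w1 \<noteq> 0) \<and> x1 = n * w0^2 \<and> x3 = n * w1^2 \<and>
      x0 + x2 = c * n * w0 * w1"
  proof (cases "x3 = 0")
    case True
    then have "x0 + x2 = 0" using e1 by simp
    moreover have "x1 \<noteq> 0"
    proof
      assume "x1 = 0"
      with True e2 c \<open>x0 + x2 = 0\<close> have "x0 = 0 \<and> x2 = 0" by (auto simp: add0_iff)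
      with v(2) x True \<open>x1 = 0\<close> show False by simp
    qed
    ultimately show ?thesis
      using True by (intro exI[of _ x1] exI[of _ 1] exI[of _ 0]) simp
  next
    case False
    with c e1 show ?thesis
      by (intro exI[of _ "1 / (c^2 * x3)"] exI[of _ "x0 + x2"] exI[of _ "c * x3"])
        (simp add: field_simps power2_eq_square)
  qed
  from U obtain m u0 u1 where U: "m \<noteq> 0" "u0 \<noteq> 0 \<or> u1 \<noteq> 0" "x0 = m * u0^2" "x2 = m * u1^2"
    "x1 + x3 = c * m * u0 * u1" by blast
  from W obtain n w0 w1 where W: "n \<noteq> 0" "w0 \<noteq> 0 \<or> w1 \<noteq> 0" "x1 = n * w0^2" "x3 = n * w1^2"
    "x0 + x2 = c * n * w0 * w1" by blast
  have "mu4_rel c m n u0 u1 w0 w1"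
    using U(1,2) W(1,2) unfolding mu4_rel_def sq_add distrib_left
      U(3)[symmetric] U(4)[symmetric] W(3)[symmetric] W(4)[symmetric] U(5) W(5) by simp
  then show ?thesis using that v(1) unfolding x U(3,4) W(3,4) by blast
qed

lemma mu4_to_Z4_inj:
  assumes c: "(c::'k) \<noteq> 0"
  shows "inj_on (mu4_to_Z4 c) (mu4_points c)"
proof (rule inj_onI)
  fix S T assume S: "S \<in> mu4_points c" and T: "T \<in> mu4_points c"
    and eq: "mu4_to_Z4 c S = mu4_to_Z4 c T"
  obtain m n u0 u1 w0 w1 where 1: "mu4_rel c m n u0 u1 w0 w1"
    "S = proj3 (m * u0^2, n * w0^2, m * u1^2, n * w1^2)" using mu4_param[OF c S] .
  obtain m' n' v0 v1 y0 y1 where 2: "mu4_rel c m' n' v0 v1 y0 y1"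
    "T = proj3 (m' * v0^2, n' * y0^2, m' * v1^2, n' * y1^2)" using mu4_param[OF c T] .
  from eq obtain l where l: "l \<noteq> 0" "v0 * y0 = l * (u0 * w0)" "v1 * y0 = l * (u1 * w0)"
    "v1 * y1 = l * (u1 * w1)" "v0 * y1 = l * (u0 * w1)"
    unfolding 1(2) 2(2) mu4_rel_points(2)[OF c 1(1)] mu4_rel_points(2)[OF c 2(1)]
    using proj3_eqD by metis
  have nz: "u0 \<noteq> 0 \<or> u1 \<noteq> 0" "w0 \<noteq> 0 \<or> w1 \<noteq> 0" "m \<noteq> 0" "n \<noteq> 0"
    and nz': "v0 \<noteq> 0 \<or> v1 \<noteq> 0" "y0 \<noteq> 0 \<or> y1 \<noteq> 0" "m' \<noteq> 0" "n' \<noteq> 0"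
    using 1(1) 2(1) by (auto simp: mu4_rel_def)
  obtain a where a: "a \<noteq> 0" "v0 = a * u0" "v1 = a * u1"
  proof (cases "w0 = 0")
    case False
    then have "y0 \<noteq> 0" using l nz by auto
    then show ?thesis using that[of "l * w0 / y0"] l False by (simp add: field_simps)
  next
    case True
    then have "w1 \<noteq> 0" using nz by simp
    moreover from this have "y1 \<noteq> 0" using l nz by auto
    ultimately show ?thesis using that[of "l * w1 / y1"] l by (simp add: field_simps)
  qed
  obtain b where b: "b \<noteq> 0" "y0 = b * w0" "y1 = b * w1"
  proof -
    have "y0 = l / a * w0" "y1 = l / a * w1"
      using l(2-5) nz(1) a by (auto simp: field_simps)
    then show ?thesis using that[of "l / a"] a l(1) by simp
  qed
  define M N where "M = m' * a^2" and "N = n' * b^2"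
  have T: "T = proj3 (M * u0^2, N * w0^2, M * u1^2, N * w1^2)"
    by (simp add: 2(2) a b M_def N_def power_mult_distrib mult.assoc)
  have MN: "M \<noteq> 0" "N \<noteq> 0" using nz' a b by (simp_all add: M_def N_def)
  have ea: "a * u0 + a * u1 = a * (u0 + u1)" "b * w0 + b * w1 = b * (w0 + w1)"
    by (simp_all add: distrib_left)
  have f: "M * (u0 + u1)^2 = c * N * w0 * w1" "N * (w0 + w1)^2 = c * M * u0 * u1"
    using 2(1) unfolding mu4_rel_def a b ea
    by (simp_all add: M_def N_def power_mult_distrib power2_eq_square ac_simps)
  have e: "m * (u0 + u1)^2 = c * n * w0 * w1" "n * (w0 + w1)^2 = c * m * u0 * u1"
    using 1(1) by (auto simp: mu4_rel_def)
  have "M * n = m * N"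
  proof (cases "w0 * w1 = 0")
    case False
    have "M * (c * n * w0 * w1) = m * (c * N * w0 * w1)"
      unfolding f[symmetric] e[symmetric] by simp
    then show ?thesis using c False by simp
  next
    case True
    then have "(u0 + u1)^2 = 0" using e(1) nz by auto
    then have "u0 * u1 \<noteq> 0" using nz by (auto simp: add0_iff)
    moreover have "n * (c * M * u0 * u1) = N * (c * m * u0 * u1)"
      unfolding f[symmetric] e[symmetric] by simp
    ultimately show ?thesis using c by (simp add: ac_simps)
  qed
  then have "M = M / m * m \<and> N = M / m * n"
    using nz by (simp add: field_simps)
  then obtain k where k: "M = k * m" "N = k * n" by blast
  have "T = proj3 (k * (m * u0^2), k * (n * w0^2), k * (m * u1^2), k * (n * w1^2))"
    unfolding T k by (simp add: mult.assoc)
  also have "\<dots> = S" unfolding 1(2) by (rule proj3_scale) (use MN k in simp)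
  finally show "S = T" ..
qed

lemma mu4_to_Z4_surj:
  assumes c: "(c::'k) \<noteq> 0" and Q: "Q \<in> Z4_points c"
  shows "Q \<in> mu4_to_Z4 c ` mu4_points c"
proof -
  from Q obtain x0 x1 x2 x3 where Q: "Q = proj3 (x0, x1, x2, x3)"
    and nz: "(x0, x1, x2, x3) \<noteq> (0, 0, 0, 0)"
    and e1: "(x0 + x1 + x2 + x3)^2 = c^2 * x0 * x2"
    and e2: "(x0 + x1 + x2 + x3)^2 = c^2 * x1 * x3"
    by (rule Z4_pointsE)
  have q: "x0 * x2 = x1 * x3" using e1 e2 c by (simp add: ac_simps)
  obtain u0 u1 w0 w1 where uw: "x0 = u0 * w0" "x1 = u1 * w0" "x2 = u1 * w1" "x3 = u0 * w1"
  proof (cases "x0 = 0")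
    case False
    then show ?thesis using that[of 1 x0 "x1 / x0" x3] q by (simp add: field_simps)
  next
    case True
    show ?thesis
    proof (cases "x1 = 0")
      case False
      then have "x3 = 0" using q True by simp
      then show ?thesis using that[of 0 x1 1 x2] True by simp
    next
      case x1: True
      then show ?thesis using that[of x3 0 x2 1] True by simp
    qed
  qed
  have nz: "u0 \<noteq> 0 \<or> u1 \<noteq> 0" "w0 \<noteq> 0 \<or> w1 \<noteq> 0" using nz uw by auto
  have "x0 + x1 + x2 + x3 = (u0 + u1) * (w0 + w1)" unfolding uw by (simp add: algebra_simps)
  then have e: "(u0 + u1)^2 * (w0 + w1)^2 = c^2 * u0 * u1 * w0 * w1"
    using e1 by (simp add: uw power_mult_distrib ac_simps)
  have "\<exists>m n. mu4_rel c m n u0 u1 w0 w1"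
  proof (cases "w0 * w1 = 0")
    case False
    then have "u0 \<noteq> u1" using e c nz by (auto simp: char2_simps)
    then have "mu4_rel c (c * w0 * w1) ((u0 + u1)^2) u0 u1 w0 w1"
      using False nz e c unfolding mu4_rel_def
      by (simp add: add0_iff) (simp add: power2_eq_square ac_simps)
    then show ?thesis by blast
  next
    case True
    then have "w0 + w1 \<noteq> 0" using nz by auto
    moreover from this True have "u0 + u1 = 0" using e by auto
    moreover from this have "u0 * u1 \<noteq> 0" using nz by (auto simp: add0_iff)
    ultimately have "mu4_rel c ((w0 + w1)^2) (c * u0 * u1) u0 u1 w0 w1"
      using nz c True unfolding mu4_rel_def by simp
    then show ?thesis by blast
  qed
  then obtain m n where mn: "mu4_rel c m n u0 u1 w0 w1" by blast
  show ?thesis unfolding Q uw mu4_rel_points(2)[OF c mn, symmetric]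
    by (rule imageI) (rule mu4_rel_points(1)[OF c mn])
qed

lemma mu4_to_Z4_bij:
  assumes c: "(c::'k) \<noteq> 0"
  shows "bij_betw (mu4_to_Z4 c) (mu4_points c) (Z4_points c)"
proof -
  have "mu4_to_Z4 c S \<in> Z4_points c" if S: "S \<in> mu4_points c" for S
  proof -
    obtain m n u0 u1 w0 w1 where 1: "mu4_rel c m n u0 u1 w0 w1"
      "S = proj3 (m * u0^2, n * w0^2, m * u1^2, n * w1^2)" using mu4_param[OF c S] .
    then show ?thesis using mu4_rel_points[OF c 1(1)] by simp
  qed
  then show ?thesis
    unfolding bij_betw_def using mu4_to_Z4_inj[OF c] mu4_to_Z4_surj[OF c] by blast
qed

lemma Z4_identity:
  assumes "(c::'k) \<noteq> 0"
  shows "proj3 (1, 0, 0, 1) \<in> Z4_points c"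
    and "Z4_to_weierstrass c (proj3 (1, 0, 0, 1)) = At_Infinity"
proof -
  show "proj3 (1, 0, 0, 1) \<in> Z4_points c"
    unfolding Z4_points_def by (rule imageI) (simp add: Z4_eqn_iff dbl0)
qed (simp add: Z4_to_weierstrass_proj3)

lemma mu4_identity:
  assumes "(c::'k) \<noteq> 0"
  shows "proj3 (c, 1, 0, 1) \<in> mu4_points c"
    and "mu4_to_Z4 c (proj3 (c, 1, 0, 1)) = proj3 (1, 0, 0, 1)"
proof -
  show "proj3 (c, 1, 0, 1) \<in> mu4_points c"
    unfolding mu4_points_def by (rule imageI) (simp add: mu4_eqn_def dbl0 two0)
  show "mu4_to_Z4 c (proj3 (c, 1, 0, 1)) = proj3 (1, 0, 0, 1)"
    using assms proj3_scale[of "c^3" 1 0 0 1]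
    by (simp add: mu4_to_Z4_proj3 dbl0 two0 power3_eq_cube mult.assoc)
qed

lemma mu4_kummer_Z4:
  assumes c: "(c::'k) \<noteq> 0" and S: "S \<in> mu4_points c"
  shows "mu4_kummer c S = Z4_kummer (mu4_to_Z4 c S)"
proof -
  obtain m n u0 u1 w0 w1 where rel: "mu4_rel c m n u0 u1 w0 w1"
    and S: "S = proj3 (m * u0^2, n * w0^2, m * u1^2, n * w1^2)" using mu4_param[OF c S] .
  have nz: "m \<noteq> 0" "u0 \<noteq> 0 \<or> u1 \<noteq> 0" "w0 \<noteq> 0 \<or> w1 \<noteq> 0"
    and B: "n * w0^2 + n * w1^2 = c * m * u0 * u1"
    using rel by (simp_all add: mu4_rel_def sq_add distrib_left)
  have "mu4_kummer c S = proj1 (u0, u1)"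
  proof (cases "u0 = 0")
    case True
    then show ?thesis
      using nz c proj1_scale[of "c * m * u1" 0 u1]
      unfolding S mu4_kummer_proj3 B by (simp add: power2_eq_square mult.assoc)
  next
    case False
    then show ?thesis
      using nz c proj1_scale[of "c * m * u0" u0 u1]
      unfolding S mu4_kummer_proj3 B by (simp add: power2_eq_square mult.assoc)
  qed
  moreover have "Z4_kummer (mu4_to_Z4 c S) = proj1 (u0, u1)"
    using nz proj1_scale[of w0 u0 u1] proj1_scale[of w1 u0 u1]
    by (auto simp: S mu4_rel_points(2)[OF c rel] Z4_kummer_proj3 mult.commute)
  ultimately show ?thesis by simp
qed

end

lemma Z4_elliptic_iff:
  assumes char2: "CHAR('k::alg_closed_field) = 2"
  shows "Z4_elliptic (c::'k) \<longleftrightarrow> c \<noteq> 0"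
proof -
  note [simp] = two0[OF char2]
  note a0 = add0_iff[OF char2]
  show ?thesis
  proof
    assume e: "Z4_elliptic c"
    show "c \<noteq> 0"
    proof
      assume "c = 0"
      with e[unfolded Z4_elliptic_def, rule_format, of 1 0 0 1 1 0]
      show False by (simp add: Z4_eqn_def a0 Let_def)
    qed
  next
    assume c: "c \<noteq> 0"
    show "Z4_elliptic c"
      unfolding Z4_elliptic_def Let_def using c
      by (auto simp: Z4_eqn_def)
  qed
qed

end

theory Submission
  imports Defs
begin

text \<open>
  Both curves are carried to \<open>y\<^sup>2 + x y = x\<^sup>3 + b x\<close> with \<open>b = 1 / c\<^sup>4\<close>, where the Kummer map is
  \<open>(c\<^sup>2 x : 1)\<close>.  For affine points with abscissas \<open>x \<noteq> x'\<close>, the abscissas of their sum and of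
  their difference have product \<open>(x x' + b)\<^sup>2 / (x + x')\<^sup>2\<close> and sum \<open>x x' / (x + x')\<^sup>2\<close>.  The product
  gives the formula for the second component.  The sum, or doubling when \<open>x = x'\<close>, shows that the second component is
  determined by the Kummer images and \<open>P\<close> even where that formula degenerates to \<open>(0, 0)\<close>, so the
  definite description in \<open>kummer_montgomery\<close> always has a unique solution.  Neither
  argument uses associativity of the group law.
\<close>

section \<open>The chord-tangent law in characteristic two\<close>

text \<open>The general negative ordinate \<open>- y - a1 * x - a3\<close> becomes
  \<open>y + x\<close> for \<open>a1 = 1\<close>, \<open>a3 = 0\<close> in characteristic
  two.\<close>

fun wneg :: "'k::field wpoint \<Rightarrow> 'k wpoint" where
  "wneg At_Infinity = At_Infinity"
| "wneg (Affine x y) = Affine x (y + x)"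

fun wkummer :: "'k::field \<Rightarrow> 'k wpoint \<Rightarrow> 'k P1" where
  "wkummer c At_Infinity = proj1 (1, 0)"
| "wkummer c (Affine x y) = proj1 (c^2 * x, 1)"

lemma proj1_eq_iff:
  "proj1 (a0, a1) = proj1 (b0, b1) \<longleftrightarrow> (\<exists>l. l \<noteq> 0 \<and> a0 = l * b0 \<and> a1 = l * b1)"
proof
  assume "proj1 (a0, a1) = proj1 (b0, b1)"
  moreover have "(a0, a1) \<in> proj1 (a0, a1)"
    unfolding proj1_def by (auto intro!: exI[of _ 1])
  ultimately have "(a0, a1) \<in> proj1 (b0, b1)" by simp
  then show "\<exists>l. l \<noteq> 0 \<and> a0 = l * b0 \<and> a1 = l * b1" by (auto simp: proj1_def)
qed (auto simp: proj1_scale)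

text \<open>A Kummer value is never the degenerate class, so an equality with one also excludes the
  coordinate vector \<open>(0, 0)\<close>. This and the affine version below turn statements about
  classes into equations between coordinates.\<close>

lemma proj1_eq_wkummer_At_Infinity:
  "proj1 (a0, a1) = wkummer c At_Infinity \<longleftrightarrow> a0 \<noteq> 0 \<and> a1 = 0"
  by (auto simp: proj1_eq_iff)

lemma proj1_eq_wkummer_Affine:
  "proj1 (a0, a1) = wkummer c (Affine x y) \<longleftrightarrow> a1 \<noteq> 0 \<and> a0 = c^2 * x * a1"
  by (auto simp: proj1_eq_iff)

lemmas proj1_eq_wkummer = proj1_eq_wkummer_At_Infinity proj1_eq_wkummer_Affine

lemma wkummer_surj: "\<exists>a0 a1. wkummer c p = proj1 (a0, a1)"
  by (cases p) auto

lemma wkummer_eqD: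
  assumes "c \<noteq> 0" "wkummer c (Affine x y) = wkummer c q"
  obtains y' where "q = Affine x y'"
  using assms by (cases q) (auto simp: proj1_eq_iff)

lemma wkummer_eq_At_Infinity: "wkummer c p = wkummer c At_Infinity \<longleftrightarrow> p = At_Infinity"
  by (cases p) (auto simp: proj1_eq_iff)

context
  fixes c :: "'k::field"
  assumes char2: "CHAR('k) = 2" and c: "c \<noteq> 0"
begin

abbreviation (input) curve :: "'k wpoint set" where
  "curve \<equiv> on_weierstrass (Z4_weierstrass c)"

abbreviation (input) wadd :: "'k wpoint \<Rightarrow> 'k wpoint \<Rightarrow> 'k wpoint" where
  "wadd \<equiv> weierstrass_add (Z4_weierstrass c)"

lemmas c2 = char2_simps[OF char2]
lemmas c2_add0 = add0_iff[OF char2]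

lemma Affine_on_curve:
  "Affine x y \<in> curve \<longleftrightarrow> y^2 + x * y = x^3 + x / c^4"
  by (simp add: on_weierstrass_def Z4_weierstrass_def)

lemma At_Infinity_on_curve: "At_Infinity \<in> curve"
  by (simp add: on_weierstrass_def Z4_weierstrass_def)

lemma wadd_At_Infinity: "wadd At_Infinity q = q" "wadd p At_Infinity = p"
  by (cases p; simp)+

lemma three1: "(3::'k) = 1"
proof -
  have "(3::'k) = 2 + 1" by simp
  then show ?thesis by (simp only: two0[OF char2] add_0_left)
qed

text \<open>Signs disappear and \<open>2 * y1 = 0\<close>, so the tangent slope has denominator
  \<open>x1\<close>. The factor \<open>m + 1\<close> in the ordinate is the line evaluated at the
  new abscissa followed by the reflection \<open>y + x\<close>.\<close>

lemma wadd_Affine: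
  "wadd (Affine x1 y1) (Affine x2 y2) =
     (if x1 = x2 \<and> y1 + y2 + x2 = 0 then At_Infinity
      else let m = (if x1 = x2 then (x1^2 + 1 / c^4 + y1) / x1 else (y1 + y2) / (x1 + x2))
           in Affine (m^2 + m + x1 + x2) ((m + 1) * (m^2 + m + x1 + x2) + y1 + m * x1))"
proof -
  have "m^2 + m - x1 - x2 = m^2 + m + x1 + x2" for m :: 'k by (simp add: c2)
  moreover have "- z - (y1 - m * x1) = z + y1 + m * x1" for m z :: 'k by (simp add: c2)
  ultimately show ?thesis
    by (simp add: Z4_weierstrass_def Let_def three1 c2 ac_simps)
qed

lemma wneg_on_curve: "p \<in> curve \<Longrightarrow> wneg p \<in> curve"
  by (cases p) (auto simp: Affine_on_curve At_Infinity_on_curve c2 algebra_simps power2_eq_square)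

lemma wkummer_wneg: "wkummer c (wneg p) = wkummer c p"
  by (cases p) auto

lemma wadd_eq_At_Infinity_iff: "wadd p q = At_Infinity \<longleftrightarrow> q = wneg p"
proof (cases p; cases q)
  fix x y x' y' assume pq: "p = Affine x y" "q = Affine x' y'"
  have "y + y' + x' = 0 \<longleftrightarrow> y' = y + x'"
    using c2_add0 by (metis add.assoc add.commute)
  then show ?thesis by (auto simp: pq wadd_Affine Let_def)
qed (auto simp: wadd_At_Infinity)

text \<open>For a fixed abscissa \<open>x\<close> the curve equation is quadratic in the ordinate,
  and its two roots differ by \<open>x\<close>.\<close>

lemma same_abscissa:
  assumes "Affine x y \<in> curve" "Affine x y' \<in> curve"
  shows "y' = y \<or> y' = y + x"
proof -
  have "(y' + y) * (y' + (y + x)) = (y'^2 + x * y') + (y^2 + x * y)"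
    by (simp add: algebra_simps c2 power2_eq_square)
  also have "\<dots> = 0" using assms by (simp add: Affine_on_curve c2)
  finally show ?thesis using c2_add0 by simp
qed

section \<open>Closure of the curve under the chord-tangent law\<close>

text \<open>
  The line \<open>y = m x + n\<close> meets the curve in the roots of
  \<open>x\<^sup>3 + (m\<^sup>2 + m) x\<^sup>2 + (b + n) x + n\<^sup>2\<close>; the second hypothesis is the divided difference of
  this cubic at \<open>x1, x2\<close>, which also covers tangency.
\<close>

lemma third_intersection:
  fixes x1 x2 m n b :: 'k
  defines "x3 \<equiv> m^2 + m + x1 + x2"
  assumes f: "x1^3 + (m^2 + m) * x1^2 + (b + n) * x1 + n^2 = 0"
    and d: "x1^2 + x1 * x2 + x2^2 + (m^2 + m) * (x1 + x2) + (b + n) = 0"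
  shows "x3^3 + (m^2 + m) * x3^2 + (b + n) * x3 + n^2 = 0"
proof -
  \<comment> \<open>The choice of \<open>x3\<close> makes the second divided difference
    \<open>x1 + x2 + x3 + (m^2 + m)\<close> zero. Hence the first divided difference at
    \<open>x1, x3\<close> equals the one at \<open>x1, x2\<close>.\<close>
  have "x3^3 + (m^2 + m) * x3^2 + (b + n) * x3 + n^2 =
    x1^3 + (m^2 + m) * x1^2 + (b + n) * x1 + n^2 +
    (x3 + x1) * (x1^2 + x1 * x2 + x2^2 + (m^2 + m) * (x1 + x2) + (b + n))"
    unfolding x3_def by (simp add: algebra_simps power2_eq_square power3_eq_cube c2)
  then show ?thesis using f d by simp
qed

lemma wadd_on_curve:
  assumes p: "p \<in> curve" and q: "q \<in> curve"
  shows "wadd p q \<in> curve"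
proof (cases p; cases q)
  fix x1 y1 x2 y2 assume pq: "p = Affine x1 y1" "q = Affine x2 y2"
  have e1: "y1^2 + x1 * y1 = x1^3 + x1 / c^4" and e2: "y2^2 + x2 * y2 = x2^3 + x2 / c^4"
    using p q by (simp_all add: pq Affine_on_curve)
  show ?thesis
  proof (cases "x1 = x2 \<and> y1 + y2 + x2 = 0")
    case True
    then show ?thesis by (simp add: pq wadd_Affine At_Infinity_on_curve)
  next
    case False
    define b where "b = 1 / c^4"
    define m where "m = (if x1 = x2 then (x1^2 + b + y1) / x1 else (y1 + y2) / (x1 + x2))"
    define n where "n = y1 + m * x1"
    define x3 where "x3 = m^2 + m + x1 + x2"
    have y1: "y1 = m * x1 + n" by (simp add: n_def c2)
    have e1: "(m * x1 + n)^2 + x1 * (m * x1 + n) = x1^3 + b * x1"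
      using e1 by (simp add: b_def flip: y1)
    have "x1^3 + (m^2 + m) * x1^2 + (b + n) * x1 + n^2 =
        ((m * x1 + n)^2 + x1 * (m * x1 + n)) + (x1^3 + b * x1)"
      by (simp add: algebra_simps power2_eq_square power3_eq_cube c2)
    then have f: "x1^3 + (m^2 + m) * x1^2 + (b + n) * x1 + n^2 = 0"
      unfolding e1[unfolded c2] c2 .
    have d: "x1^2 + x1 * x2 + x2^2 + (m^2 + m) * (x1 + x2) + (b + n) = 0"
    proof (cases "x1 = x2")
      case True
      \<comment> \<open>The other ordinate over \<open>x1\<close> is the negative, which
        \<open>False\<close> excludes. The line is therefore the tangent, and its slope makes the
        derivative \<open>x1^2 + b + n\<close> of the cubic vanish.\<close>
      then have "y2 = y1" using False same_abscissa p q pq by (force simp: c2 ac_simps)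
      then have "x1 \<noteq> 0" using True False by (simp add: c2)
      then have "m * x1 = x1^2 + b + y1" by (simp add: m_def True)
      then have "b + n = x1^2" by (simp add: n_def c2 ac_simps)
      then show ?thesis by (simp flip: True add: c2 power2_eq_square)
    next
      case x: False
      then have x12: "x1 + x2 \<noteq> 0" by (simp add: c2_add0)
      then have "m * (x1 + x2) = y1 + y2" using x by (simp add: m_def)
      then have "y2 = m * x2 + n" by (simp add: n_def algebra_simps c2)
      then have e2: "(m * x2 + n)^2 + x2 * (m * x2 + n) = x2^3 + b * x2"
        using e2 by (simp add: b_def)
      \<comment> \<open>For a chord both abscissas are roots of the cubic. Their divided difference
        times \<open>x1 + x2\<close> is the sum of two vanishing values.\<close>
      have "(x1 + x2) * (x1^2 + x1 * x2 + x2^2 + (m^2 + m) * (x1 + x2) + (b + n)) =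
         ((m * x1 + n)^2 + x1 * (m * x1 + n)) + (x1^3 + b * x1) +
         ((m * x2 + n)^2 + x2 * (m * x2 + n) + (x2^3 + b * x2))"
        by (simp add: algebra_simps power2_eq_square power3_eq_cube c2)
      also have "\<dots> = 0" unfolding e1 e2 by (simp add: dbl0[OF char2])
      finally show ?thesis using x12 by simp
    qed
    have g: "x3^3 + (m^2 + m) * x3^2 + (b + n) * x3 + n^2 = 0"
      unfolding x3_def by (rule third_intersection[OF f d])
    \<comment> \<open>Passing from \<open>m\<close> to \<open>m + 1\<close> is the reflection
      \<open>y + x\<close> at \<open>x3\<close>, which preserves the curve equation.\<close>
    have "((m + 1) * x3 + n)^2 + x3 * ((m + 1) * x3 + n) =
       (x3^3 + (m^2 + m) * x3^2 + (b + n) * x3 + n^2) + (x3^3 + b * x3)"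
      by (simp add: algebra_simps power2_eq_square power3_eq_cube c2)
    then have "Affine x3 ((m + 1) * x3 + n) \<in> curve"
      unfolding g by (simp add: Affine_on_curve b_def)
    moreover have "wadd p q = Affine x3 ((m + 1) * x3 + n)"
      using False by (auto simp: pq wadd_Affine Let_def x3_def n_def m_def b_def add.assoc)
    ultimately show ?thesis by simp
  qed
qed (use p q in \<open>auto simp: wadd_At_Infinity\<close>)

section \<open>Doubling and differential addition in Kummer coordinates\<close>

lemma wkummer_double:
  assumes p: "p \<in> curve" and U: "proj1 (U0, U1) = wkummer c p"
  shows "wkummer c (wadd p p) = proj1 (U0^4 + U1^4, c^2 * U0^2 * U1^2)"
proof (cases p)
  case At_Infinity
  with U have "U0 \<noteq> 0" "U1 = 0" by (auto simp only: proj1_eq_wkummer)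
  then have "proj1 (U0^4 + U1^4, c^2 * U0^2 * U1^2) = wkummer c At_Infinity"
    unfolding proj1_eq_wkummer by simp
  then show ?thesis by (simp add: At_Infinity)
next
  case (Affine x y)
  with U have U: "U1 \<noteq> 0" "U0 = c^2 * x * U1" by (auto simp only: proj1_eq_wkummer)
  have e: "y^2 + x * y = x^3 + x / c^4" using p by (simp add: Affine Affine_on_curve)
  show ?thesis
  proof (cases "x = 0")
    \<comment> \<open>At abscissa zero the tangent is vertical and \<open>U0 = 0\<close>, so the
      formula gives \<open>(U1^4 : 0)\<close>, the image of the identity.\<close>
    case True
    then have "proj1 (U0^4 + U1^4, c^2 * U0^2 * U1^2) = wkummer c At_Infinity"
      unfolding proj1_eq_wkummer using U by simp
    then show ?thesis using True by (simp add: Affine wadd_Affine c2)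
  next
    case False
    define m where "m = (x^2 + 1 / c^4 + y) / x"
    have "m^2 + m = (x^4 + 1 / c^8) / x^2"
    \<comment> \<open>Multiplying by \<open>x^2\<close> expresses everything through
      \<open>m * x\<close>, which is linear in \<open>y\<close>. The curve equation then removes the
      ordinate.\<close>
    proof -
      have "x^2 * (m^2 + m) = (m * x)^2 + x * (m * x)"
        by (simp add: algebra_simps power2_eq_square)
      also have "\<dots> = (x^2 + 1 / c^4 + y)^2 + x * (x^2 + 1 / c^4 + y)"
        using False by (simp add: m_def)
      also have "\<dots> = x^4 + 1 / c^8 + (y^2 + x * y) + (x^3 + x / c^4)"
        by (simp add: sq_add[OF char2] algebra_simps power_divide)
          (simp add: eval_nat_numeral)
      also have "\<dots> = x^4 + 1 / c^8" by (simp add: e c2 add.assoc)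
      finally show ?thesis using False by (simp add: field_simps)
    qed
    moreover have "wadd p p = Affine (m^2 + m) ((m + 1) * (m^2 + m) + y + m * x)"
      using False by (simp add: Affine wadd_Affine c2 Let_def m_def add.assoc)
    \<comment> \<open>Substituting \<open>U0 = c^2 * x * U1\<close> shows where the coefficient
      \<open>c^2\<close> of \<open>U0^2 * U1^2\<close> comes from.\<close>
    moreover have "c^2 * ((x^4 + 1 / c^8) / x^2) * (c^2 * U0^2 * U1^2) = U0^4 + U1^4"
      using False U c by (simp add: field_simps) (simp add: eval_nat_numeral algebra_simps)
    moreover have "c^2 * U0^2 * U1^2 \<noteq> 0" using False U c by simp
    ultimately show ?thesis using proj1_eq_wkummer_Affine by metis
  qed
qed

text \<open>Clearing the denominator and eliminating the squares of the ordinates by the curve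
  equation leaves only the mixed term \<open>x * y' + x' * y\<close>. Negating the second point
  changes that term by \<open>x * x'\<close>.\<close>

lemma wadd_distinct_abscissas:
  assumes "Affine x y \<in> curve" "Affine x' y' \<in> curve" "x \<noteq> x'"
  obtains s where
    "wadd (Affine x y) (Affine x' y') =
       Affine (((x + x') * (x * x' + 1 / c^4) + (x * y' + x' * y)) / (x + x')^2) s"
proof -
  define m where "m = (y + y') / (x + x')"
  have nz: "x + x' \<noteq> 0" using assms by (simp add: c2_add0)
  have "(x + x')^2 * (m^2 + m + x + x') =
      (m * (x + x'))^2 + (m * (x + x')) * (x + x') + (x + x')^3"
    by (simp add: algebra_simps power2_eq_square power3_eq_cube)
  also have "\<dots> = (y + y')^2 + (y + y') * (x + x') + (x + x')^3"
    using nz by (simp add: m_def)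
  also have "\<dots> = (y^2 + x * y) + (y'^2 + x' * y') + (x * y' + x' * y) + (x + x')^3"
    by (simp add: algebra_simps power2_eq_square power3_eq_cube c2)
  also have "\<dots> = (x^3 + x / c^4) + (x'^3 + x' / c^4) + (x * y' + x' * y) + (x + x')^3"
    using assms(1,2) by (simp add: Affine_on_curve)
  also have "\<dots> = (x + x') * (x * x' + 1 / c^4) + (x * y' + x' * y)"
    by (simp add: algebra_simps power2_eq_square power3_eq_cube c2 add_divide_distrib)
  finally have "m^2 + m + x + x' =
      ((x + x') * (x * x' + 1 / c^4) + (x * y' + x' * y)) / (x + x')^2"
    using nz by (simp add: field_simps)
  then show ?thesis using that assms(3) by (simp add: wadd_Affine Let_def m_def)
qed

text \<open>The mixed terms \<open>N\<close> and \<open>N + x * x'\<close> of sum and difference are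
  the two roots of a quadratic whose coefficients involve only the abscissas. The symmetric
  functions of the two resulting abscissas are therefore free of ordinates.\<close>

lemma wadd_wneg_distinct_abscissas:
  assumes p: "Affine x y \<in> curve" and q: "Affine x' y' \<in> curve" and x: "x \<noteq> x'"
  obtains a s d t where
    "wadd (Affine x y) (Affine x' y') = Affine a s"
    "wadd (Affine x y) (wneg (Affine x' y')) = Affine d t"
    "a + d = x * x' / (x + x')^2"
    "a * d = (x * x' + 1 / c^4)^2 / (x + x')^2"
proof -
  have q': "Affine x' (y' + x') \<in> curve" using wneg_on_curve[OF q] by simp
  define N where "N = x * y' + x' * y"
  define A where "A = (x + x') * (x * x' + 1 / c^4)"
  have nz: "x + x' \<noteq> 0" using x by (simp add: c2_add0)
  have N': "x * (y' + x') + x' * y = N + x * x'" by (simp add: N_def algebra_simps)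
  obtain s where s: "wadd (Affine x y) (Affine x' y') = Affine ((A + N) / (x + x')^2) s"
    using wadd_distinct_abscissas[OF p q x] unfolding A_def N_def by blast
  obtain t where t: "wadd (Affine x y) (wneg (Affine x' y')) =
      Affine ((A + (N + x * x')) / (x + x')^2) t"
    using wadd_distinct_abscissas[OF p q' x] unfolding A_def N' by auto
  \<comment> \<open>This is the quadratic equation for \<open>N\<close>; in the product below it
    makes everything except \<open>A^2\<close> cancel.\<close>
  have "N^2 = x^2 * (y'^2 + x' * y') + x'^2 * (y^2 + x * y) + x * x' * N"
    by (simp add: N_def algebra_simps power2_eq_square c2)
  also have "\<dots> = x^2 * (x'^3 + x' / c^4) + x'^2 * (x^3 + x / c^4) + x * x' * N"
    using p q by (simp add: Affine_on_curve)
  also have "\<dots> = x * x' * (A + N)"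
    by (simp add: A_def algebra_simps power2_eq_square power3_eq_cube add_divide_distrib)
  finally have N2: "N^2 = x * x' * (A + N)" .
  have "(A + N) * (A + (N + x * x')) = A^2 + N^2 + x * x' * (A + N)"
    by (simp add: algebra_simps power2_eq_square c2)
  also have "\<dots> = A^2" by (simp add: N2 add.assoc dbl0[OF char2])
  also have "\<dots> = (x + x')^2 * (x * x' + 1 / c^4)^2"
    by (simp add: A_def power_mult_distrib)
  finally have "(A + N) / (x + x')^2 * ((A + (N + x * x')) / (x + x')^2) =
      (x * x' + 1 / c^4)^2 / (x + x')^2"
    using nz by (simp add: power2_eq_square)
  moreover have "(A + N) / (x + x')^2 + (A + (N + x * x')) / (x + x')^2 = x * x' / (x + x')^2"
    by (simp add: c2 ac_simps flip: add_divide_distrib)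
  ultimately show ?thesis using that s t by blast
qed

lemma wkummer_differential_add:
  assumes p: "p \<in> curve" and q: "q \<in> curve"
    and U: "proj1 (U0, U1) = wkummer c p" and V: "proj1 (V0, V1) = wkummer c q"
    and T: "proj1 (T0, T1) = wkummer c (wadd p (wneg q))"
    and nz: "(T1 * (U0 * V0 + U1 * V1)^2, T0 * (U0 * V1 + U1 * V0)^2) \<noteq> (0, 0)"
  shows "wkummer c (wadd p q) =
    proj1 (T1 * (U0 * V0 + U1 * V1)^2, T0 * (U0 * V1 + U1 * V0)^2)"
proof (cases p)
  case At_Infinity
  with U have U: "U0 \<noteq> 0" "U1 = 0" by (auto simp only: proj1_eq_wkummer)
  have "proj1 (T0, T1) = proj1 (V0, V1)"
    using T V by (simp add: At_Infinity wkummer_wneg)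
  then obtain l where l: "l \<noteq> 0" "T0 = l * V0" "T1 = l * V1" by (auto simp: proj1_eq_iff)
  \<comment> \<open>Here the sum is \<open>q\<close> and the difference has the Kummer image of
    \<open>q\<close>. The formula returns \<open>(V0, V1)\<close> scaled by \<open>k\<close>, and
    \<open>k = 0\<close> is the excluded degenerate case.\<close>
  define k where "k = l * U0^2 * V0 * V1"
  have k: "T1 * (U0 * V0 + U1 * V1)^2 = k * V0" "T0 * (U0 * V1 + U1 * V0)^2 = k * V1"
    by (simp_all add: U l k_def power2_eq_square)
  have "k \<noteq> 0" using nz unfolding k by auto
  from proj1_scale[OF this] show ?thesis
    unfolding k by (simp add: At_Infinity V)
next
  case p': (Affine x y)
  with U have U': "U1 \<noteq> 0" "U0 = c^2 * x * U1" by (auto simp only: proj1_eq_wkummer)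
  show ?thesis
  proof (cases q)
    case At_Infinity
    with V have V: "V0 \<noteq> 0" "V1 = 0" by (auto simp only: proj1_eq_wkummer)
    have "proj1 (T0, T1) = proj1 (U0, U1)"
      using T U by (simp add: At_Infinity wadd_At_Infinity)
    then obtain l where l: "l \<noteq> 0" "T0 = l * U0" "T1 = l * U1" by (auto simp: proj1_eq_iff)
    define k where "k = l * V0^2 * U0 * U1"
    have k: "T1 * (U0 * V0 + U1 * V1)^2 = k * U0" "T0 * (U0 * V1 + U1 * V0)^2 = k * U1"
      by (simp_all add: V l k_def power2_eq_square)
    have "k \<noteq> 0" using nz unfolding k by auto
    from proj1_scale[OF this] show ?thesis
      unfolding k by (simp add: At_Infinity wadd_At_Infinity U)
  next
    case q': (Affine x' y')
    with V have V': "V1 \<noteq> 0" "V0 = c^2 * x' * V1" by (auto simp only: proj1_eq_wkummer)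
    show ?thesis
    proof (cases "x = x'")
      case True
      then have UV: "U0 * V1 + U1 * V0 = 0" using U' V' by (simp add: c2)
      \<comment> \<open>Equal abscissas annihilate the second coordinate of the formula, so
        nondegeneracy forces \<open>T1\<close> to be nonzero. The difference is then not the
        identity, and \<open>q\<close> must be the negative of \<open>p\<close>.\<close>
      have "q \<noteq> p"
      proof
        assume "q = p"
        then have "wadd p (wneg q) = At_Infinity" by (simp add: wadd_eq_At_Infinity_iff)
        with T have "T1 = 0" by (simp only: proj1_eq_wkummer)
        with nz UV show False by simp
      qed
      then have "q = wneg p" using same_abscissa p q p' q' True by auto
      then have "wadd p q = At_Infinity" by (simp add: wadd_eq_At_Infinity_iff)
      moreover have "proj1 (T1 * (U0 * V0 + U1 * V1)^2, T0 * (U0 * V1 + U1 * V0)^2) =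
          wkummer c At_Infinity"
        unfolding proj1_eq_wkummer using nz UV by simp
      ultimately show ?thesis by simp
    next
      case False
      then have nz': "x + x' \<noteq> 0" by (simp add: c2_add0)
      obtain a s d t where 1: "wadd p q = Affine a s" "wadd p (wneg q) = Affine d t"
        "a * d = (x * x' + 1 / c^4)^2 / (x + x')^2"
        using wadd_wneg_distinct_abscissas[OF p[unfolded p'] q[unfolded q'] False] p' q' by metis
      have T': "T1 \<noteq> 0" "T0 = c^2 * d * T1"
        using T unfolding 1 proj1_eq_wkummer by auto
      have X: "U0 * V1 + U1 * V0 = c^2 * (x + x') * U1 * V1"
        by (simp add: U' V' algebra_simps)
      have Y: "U0 * V0 + U1 * V1 = c^4 * (x * x' + 1 / c^4) * U1 * V1"
        using c by (simp add: U' V' field_simps)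
      \<comment> \<open>Since \<open>T0 = c^2 * d * T1\<close>, the unknown abscissa
        \<open>a\<close> enters only through the known product \<open>a * d\<close>.\<close>
      have "c^2 * a * (T0 * (U0 * V1 + U1 * V0)^2) =
          c^8 * (a * d) * (x + x')^2 * T1 * (U1 * V1)^2"
        unfolding X T' by (simp add: power_mult_distrib)
      also have "\<dots> = T1 * (U0 * V0 + U1 * V1)^2"
        unfolding Y 1(3) using nz' by (simp add: power_mult_distrib)
      finally have e: "T1 * (U0 * V0 + U1 * V1)^2 = c^2 * a * (T0 * (U0 * V1 + U1 * V0)^2)" ..
      \<comment> \<open>By \<open>e\<close> the first coordinate is a multiple of the second, so
        both would vanish together.\<close>
      have "T0 * (U0 * V1 + U1 * V0)^2 \<noteq> 0"
      proof
        assume "T0 * (U0 * V1 + U1 * V0)^2 = 0"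
        with nz show False unfolding e by (simp only: mult_zero_right simp_thms)
      qed
      then have "proj1 (T1 * (U0 * V0 + U1 * V1)^2, T0 * (U0 * V1 + U1 * V0)^2) =
          wkummer c (Affine a s)"
        unfolding proj1_eq_wkummer_Affine using e by blast
      then show ?thesis by (simp add: 1)
    qed
  qed
qed

section \<open>Independence of the chosen lift, and the degenerate locus\<close>

lemma wkummer_add_cong:
  assumes p: "p \<in> curve" "p' \<in> curve" and q: "q \<in> curve" "q' \<in> curve"
    and k: "wkummer c p = wkummer c p'" "wkummer c q = wkummer c q'"
    and d: "wadd p (wneg q) = wadd p' (wneg q')"
  shows "wkummer c (wadd p q) = wkummer c (wadd p' q')"
proof (cases p)
  case At_Infinity
  then have "p' = At_Infinity" using k wkummer_eq_At_Infinity by metis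
  then show ?thesis using At_Infinity k by simp
next
  case P: (Affine x y)
  obtain y' where P': "p' = Affine x y'" using k(1) c unfolding P by (elim wkummer_eqD)
  show ?thesis
  proof (cases q)
    case At_Infinity
    then have "q' = At_Infinity" using k wkummer_eq_At_Infinity by metis
    then show ?thesis using At_Infinity k by (simp add: wadd_At_Infinity)
  next
    case Q: (Affine u v)
    obtain v' where Q': "q' = Affine u v'" using k(2) c unfolding Q by (elim wkummer_eqD)
    show ?thesis
    proof (cases "x = u")
      case False
      obtain a s e t where 1: "wadd p q = Affine a s" "wadd p (wneg q) = Affine e t"
        "a + e = x * u / (x + u)^2"
        using wadd_wneg_distinct_abscissas[OF p(1)[unfolded P] q(1)[unfolded Q] False] P Q by metis
      obtain a' s' e' t' where 2: "wadd p' q' = Affine a' s'" "wadd p' (wneg q') = Affine e' t'"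
        "a' + e' = x * u / (x + u)^2"
        using wadd_wneg_distinct_abscissas[OF p(2)[unfolded P'] q(2)[unfolded Q'] False] P' Q'
        by metis
      have "e' = e" using 1(2) 2(2) d by simp
      \<comment> \<open>The sum \<open>a + e\<close> is used rather than the product because it
        determines \<open>a\<close> from \<open>e\<close> even when \<open>e = 0\<close>.\<close>
      with 1(3) 2(3) have "a = a'" by (metis add_right_cancel)
      then show ?thesis by (simp add: 1 2)
    next
      case True
      have eq: "wadd r (wneg s) = At_Infinity \<longleftrightarrow> wneg s = wneg r" for r s
        by (rule wadd_eq_At_Infinity_iff)
      have inj: "wneg s = wneg r \<longleftrightarrow> s = r" for r s :: "'k wpoint"
        by (cases r; cases s) auto
      show ?thesis
      proof (cases "p = q")
        case True
        \<comment> \<open>Coincidence of the two points means that their difference is the identity,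
          so it carries over to the other lift. Doubling then depends only on the Kummer
          image.\<close>
        then have "p' = q'" using d eq inj by metis
        obtain U0 U1 where "proj1 (U0, U1) = wkummer c p" using wkummer_surj by metis
        then show ?thesis using True \<open>p' = q'\<close> wkummer_double p k by metis
      next
        case False
        then have "p' \<noteq> q'" using d eq inj by metis
        have "q = wneg p" "q' = wneg p'"
          using same_abscissa p q False \<open>p' \<noteq> q'\<close> True P P' Q Q' by auto
        then show ?thesis using wadd_eq_At_Infinity_iff by metis
      qed
    qed
  qed
qed

text \<open>The formula degenerates only over a difference \<open>r\<close> that is the identity or
  has abscissa zero, and both double to the identity. For any other \<open>r\<close> both squares
  vanish, which forces \<open>q\<close> to be the negative of \<open>p\<close> and \<open>r\<close>
  to be the double of \<open>p\<close>.\<close>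

lemma difference_2_torsion:
  assumes p: "p \<in> curve" and q: "q \<in> curve"
    and U: "proj1 (U0, U1) = wkummer c p" and V: "proj1 (V0, V1) = wkummer c q"
    and T: "proj1 (T0, T1) = wkummer c r" and r: "r = wadd p (wneg q)"
    and w: "T1 * (U0 * V0 + U1 * V1)^2 = 0" "T0 * (U0 * V1 + U1 * V0)^2 = 0"
  shows "wadd r r = At_Infinity"
proof (cases r)
  case r': (Affine u v)
  with T have T': "T1 \<noteq> 0" "T0 = c^2 * u * T1" by (auto simp only: proj1_eq_wkummer)
  have "u = 0"
  proof (rule ccontr)
    assume "u \<noteq> 0"
    then have "T0 \<noteq> 0" using T' c by simp
    then have e: "U0 * V0 = U1 * V1" "U0 * V1 = U1 * V0" using w T' by (auto simp: c2_add0)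
    have "(U0, U1) \<noteq> (0, 0)" "(V0, V1) \<noteq> (0, 0)"
      using U V by (cases p; cases q; auto simp: proj1_eq_iff)+
    then have nz: "U1 \<noteq> 0" "V1 \<noteq> 0" using e by auto
    obtain x y where p': "p = Affine x y"
      using U nz by (cases p) (auto simp: proj1_eq_iff)
    obtain x' y' where q': "q = Affine x' y'"
      using V nz by (cases q) (auto simp: proj1_eq_iff)
    have U': "U0 = c^2 * x * U1" and V': "V0 = c^2 * x' * V1"
      using U V unfolding p' q' proj1_eq_wkummer by auto
    have x: "x = x'" using e(2) nz c by (simp add: U' V')
    have "q \<noteq> p"
    proof
      assume "q = p"
      then have "r = At_Infinity" by (simp add: r wadd_eq_At_Infinity_iff)
      with r' show False by simp
    qed
    then have "wneg q = p" using same_abscissa p q p' q' x by (auto simp: c2 add.assoc)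
    then have "r = wadd p p" by (simp add: r)
    then have "proj1 (T0, T1) = proj1 (U0^4 + U1^4, c^2 * U0^2 * U1^2)"
      using T wkummer_double[OF p U] by simp
    \<comment> \<open>This makes the first coordinate \<open>U0^4 + U1^4\<close> of the double zero,
      contradicting \<open>T0\<close> being nonzero.\<close>
    moreover have "U0^2 = U1^2"
    proof -
      have "U0^2 * (V0 * V1) = (U0 * V0) * (U0 * V1)" by (simp add: power2_eq_square)
      also have "\<dots> = U1^2 * (V0 * V1)" unfolding e by (simp add: power2_eq_square)
      finally show ?thesis using e nz by (metis mult_eq_0_iff mult_right_cancel)
    qed
    then have "U0^4 = U1^4" by (metis power4_eq_xxxx power2_eq_square mult.assoc)
    ultimately show False using \<open>T0 \<noteq> 0\<close> by (auto simp: proj1_eq_iff c2)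
  qed
  moreover have "r \<in> curve" unfolding r by (intro wadd_on_curve wneg_on_curve p q)
  ultimately show ?thesis using r' by (simp add: Affine_on_curve wadd_Affine c2)
qed simp

section \<open>Transfer along an isomorphism\<close>

text \<open>Only a bijection onto the Weierstrass curve that respects product, identity and Kummer
  map is assumed, so both models become instances.\<close>

lemma montgomery_transfer:
  fixes G (structure)
  assumes h: "bij_betw h (carrier G) curve"
    and one: "\<one> \<in> carrier G" "h \<one> = At_Infinity"
    and closed: "\<And>Q R. Q \<in> carrier G \<Longrightarrow> R \<in> carrier G \<Longrightarrow> Q \<otimes> R \<in> carrier G"
    and hom: "\<And>Q R. Q \<in> carrier G \<Longrightarrow> R \<in> carrier G \<Longrightarrow> h (Q \<otimes> R) = wadd (h Q) (h R)"
    and kum: "\<And>Q. Q \<in> carrier G \<Longrightarrow> kummer G Q = wkummer c (h Q)"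
    and P: "P \<in> carrier G" and T: "proj1 (T0, T1) = kummer G P"
    and z: "(proj1 (U0, U1), proj1 (V0, V1)) \<in> kummer_Delta G P"
  shows
    "let \<phi> = kummer_montgomery G P;
         z = (proj1 (U0, U1), proj1 (V0, V1));
         w = (T1 * (U0 * V0 + U1 * V1)^2, T0 * (U0 * V1 + U1 * V0)^2)
     in fst (\<phi> z) = proj1 (U0^4 + U1^4, c^2 * U0^2 * U1^2) \<and>
        (w \<noteq> (0, 0) \<longrightarrow> snd (\<phi> z) = proj1 w) \<and>
        (P \<otimes> P \<noteq> \<one> \<longrightarrow> w \<noteq> (0, 0))"
proof -
  have mem: "h Q \<in> curve" if "Q \<in> carrier G" for Q
    using h that by (auto simp: bij_betw_def)
  have inj: "Q = R" if "Q \<in> carrier G" "R \<in> carrier G" "h Q = h R" for Q R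
    using h that by (auto simp: bij_betw_def inj_on_def)
  have inv: "inv R \<in> carrier G \<and> h (inv R) = wneg (h R)" if R: "R \<in> carrier G" for R
  proof -
    have "wneg (h R) \<in> h ` carrier G"
      using h mem[OF R] wneg_on_curve by (auto simp: bij_betw_def)
    then obtain S where S: "S \<in> carrier G" "h S = wneg (h R)" by auto
    have neg2: "wneg (wneg p) = p" for p :: "'k wpoint" by (cases p) (auto simp: c2 add.assoc)
    \<comment> \<open>The inverse is a definite description. It is unique because a sum with
      \<open>h R\<close> is the identity only for \<open>wneg (h R)\<close>, and \<open>h\<close> is
      injective.\<close>
    have "inv R = S"
      unfolding m_inv_def
    proof (rule the_equality)
      show "S \<in> carrier G \<and> R \<otimes> S = \<one> \<and> S \<otimes> R = \<one>"
        using S R one by (auto intro!: inj closed simp: hom wadd_eq_At_Infinity_iff neg2)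
    next
      fix S' assume "S' \<in> carrier G \<and> R \<otimes> S' = \<one> \<and> S' \<otimes> R = \<one>"
      then show "S' = S" using S R one hom wadd_eq_At_Infinity_iff inj by metis
    qed
    with S show ?thesis by simp
  qed
  have Delta: "Q \<in> carrier G \<and> R \<in> carrier G \<and> h P = wadd (h Q) (wneg (h R))"
    if "(Q, R) \<in> Delta G P" for Q R
    using that inv hom by (auto simp: Delta_def)
  obtain Q R where D: "(Q, R) \<in> Delta G P"
    and UV: "proj1 (U0, U1) = kummer G Q" "proj1 (V0, V1) = kummer G R"
    using z by (auto simp: kummer_Delta_def kummer2_def)
  from Delta[OF D] have Q: "Q \<in> carrier G" and R: "R \<in> carrier G"
    and hP: "h P = wadd (h Q) (wneg (h R))" by auto
  note U = UV(1)[unfolded kum[OF Q]] and V = UV(2)[unfolded kum[OF R]]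
  note T = T[unfolded kum[OF P]]
  have "kummer_montgomery G P (proj1 (U0, U1), proj1 (V0, V1)) =
      (wkummer c (wadd (h Q) (h Q)), wkummer c (wadd (h Q) (h R)))"
    unfolding kummer_montgomery_def
  proof (rule the_equality)
    show "\<exists>D\<in>Delta G P. kummer2 G D = (proj1 (U0, U1), proj1 (V0, V1)) \<and>
        kummer2 G (montgomery G D) =
          (wkummer c (wadd (h Q) (h Q)), wkummer c (wadd (h Q) (h R)))"
      using D UV Q R by (intro bexI[OF _ D]) (auto simp: kummer2_def montgomery_def kum closed hom)
  next
    fix w assume "\<exists>D\<in>Delta G P. kummer2 G D = (proj1 (U0, U1), proj1 (V0, V1)) \<and>
        kummer2 G (montgomery G D) = w"
    then obtain Q' R' where D': "(Q', R') \<in> Delta G P"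
      and UV': "proj1 (U0, U1) = kummer G Q'" "proj1 (V0, V1) = kummer G R'"
      and w: "w = kummer2 G (montgomery G (Q', R'))"
      by (auto simp: kummer2_def)
    from Delta[OF D'] have Q': "Q' \<in> carrier G" and R': "R' \<in> carrier G"
      and hP': "h P = wadd (h Q') (wneg (h R'))" by auto
    note U' = UV'(1)[unfolded kum[OF Q']] and V' = UV'(2)[unfolded kum[OF R']]
    have "wkummer c (wadd (h Q') (h Q')) = wkummer c (wadd (h Q) (h Q))"
      using wkummer_double[OF mem[OF Q] U] wkummer_double[OF mem[OF Q'] U'] by simp
    \<comment> \<open>Two lifts of the same Kummer pair in \<open>Delta G P\<close> share the
      difference \<open>h P\<close>, as \<open>wkummer_add_cong\<close> requires.\<close>
    moreover have "wkummer c (wadd (h Q') (h R')) = wkummer c (wadd (h Q) (h R))"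
      using U U' V V' hP hP' by (intro wkummer_add_cong mem Q R Q' R') auto
    ultimately show "w = (wkummer c (wadd (h Q) (h Q)), wkummer c (wadd (h Q) (h R)))"
      using Q' R' by (simp add: w kummer2_def montgomery_def kum closed hom)
  qed
  moreover note wkummer_double[OF mem[OF Q] U]
  moreover note wkummer_differential_add[OF mem[OF Q] mem[OF R] U V T[unfolded hP]]
  moreover have "P \<otimes> P = \<one>"
    if "T1 * (U0 * V0 + U1 * V1)^2 = 0" "T0 * (U0 * V1 + U1 * V0)^2 = 0"
    using difference_2_torsion[OF mem[OF Q] mem[OF R] U V T hP that] P one
    by (auto intro!: inj closed simp: hom)
  ultimately show ?thesis by (auto simp: Let_def)
qed

section \<open>The two models as instances of the transfer\<close>

lemma wkummer_Z4_to_weierstrass: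
  assumes Q: "Q \<in> Z4_points c"
  shows "Z4_kummer Q = wkummer c (Z4_to_weierstrass c Q)"
proof -
  obtain x0 x1 x2 x3 where Q: "Q = proj3 (x0, x1, x2, x3)"
    and nz: "(x0, x1, x2, x3) \<noteq> (0, 0, 0, 0)"
    and e1: "(x0 + x1 + x2 + x3)^2 = c^2 * x0 * x2"
    and e2: "(x0 + x1 + x2 + x3)^2 = c^2 * x1 * x3"
    using Q by (rule Z4_pointsE[OF char2])
  have q: "x0 * x2 = x1 * x3" using e1 e2 c by (simp add: ac_simps)
  show ?thesis
  proof (cases "x1 + x2 = 0")
    case True
    then have x2: "x2 = x1" by (simp add: c2_add0)
    have "x0 + x1 + x2 + x3 = x0 + x3" by (simp add: x2 c2 ac_simps)
    with e1 have "(x0 + x3)^2 = c^2 * x0 * x1" by (simp only: x2)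
    moreover have "x1 = 0 \<or> x0 = x3" using q x2 by (auto simp: ac_simps)
    \<comment> \<open>The two cases are the identity \<open>(1:0:0:1)\<close> and the centre of
      projection \<open>(0:1:1:0)\<close>.\<close>
    ultimately have "(x1 = 0 \<and> x0 = x3) \<or> (x0 = x3 \<and> x0 = 0)"
      using c by (auto simp: dbl0[OF char2] c2_add0)
    then show ?thesis
      using nz x2 by (auto simp: Q Z4_kummer_proj3 Z4_to_weierstrass_proj3 c2 proj1_eq_iff)
  next
    case False
    \<comment> \<open>On the quadric \<open>x0 * x2 = x1 * x3\<close>, both \<open>(x0:x1)\<close>
      and \<open>(x3:x2)\<close> agree with \<open>(x0 + x3 : x1 + x2)\<close> where they are
      defined, and this is \<open>(c^2 * x : 1)\<close>.\<close>
    have "(x1 + x2) * x0 = (x0 + x3) * x1" "(x1 + x2) * x3 = (x0 + x3) * x2"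
      using q by (simp_all add: algebra_simps)
    then have "x0 = c^2 * ((x0 + x3) / (c^2 * (x1 + x2))) * x1"
      "x3 = c^2 * ((x0 + x3) / (c^2 * (x1 + x2))) * x2"
      using False c by (simp_all add: nonzero_eq_divide_eq mult.commute)
    moreover have "x1 \<noteq> 0 \<or> x0 = 0 \<and> x1 = 0 \<and> x2 \<noteq> 0" using False q by auto
    ultimately show ?thesis
      using False unfolding Q Z4_kummer_proj3 Z4_to_weierstrass_proj3
      by (simp only: if_True not_False_eq_True proj1_eq_wkummer_Affine split: if_split) auto
  qed
qed

end

lemma Z4_curve_transfer:
  assumes "CHAR('k::field) = 2" and "(c::'k) \<noteq> 0"
  defines "G \<equiv> Z4_curve c"
  shows "bij_betw (Z4_to_weierstrass c) (carrier G) (on_weierstrass (Z4_weierstrass c))"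
    and "\<one>\<^bsub>G\<^esub> \<in> carrier G" and "Z4_to_weierstrass c \<one>\<^bsub>G\<^esub> = At_Infinity"
    and "\<And>Q R. Q \<in> carrier G \<Longrightarrow> R \<in> carrier G \<Longrightarrow> Q \<otimes>\<^bsub>G\<^esub> R \<in> carrier G"
    and "\<And>Q R. Q \<in> carrier G \<Longrightarrow> R \<in> carrier G \<Longrightarrow> Z4_to_weierstrass c (Q \<otimes>\<^bsub>G\<^esub> R) =
      weierstrass_add (Z4_weierstrass c) (Z4_to_weierstrass c Q) (Z4_to_weierstrass c R)"
    and "\<And>Q. Q \<in> carrier G \<Longrightarrow> kummer G Q = wkummer c (Z4_to_weierstrass c Q)"
proof -
  note bij = Z4_to_weierstrass_bij[OF assms(1,2)]
  show "bij_betw (Z4_to_weierstrass c) (carrier G) (on_weierstrass (Z4_weierstrass c))"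
    using bij by (simp add: G_def Z4_curve_def)
  show "\<one>\<^bsub>G\<^esub> \<in> carrier G" "Z4_to_weierstrass c \<one>\<^bsub>G\<^esub> = At_Infinity"
    using Z4_identity[OF assms(1,2)] by (simp_all add: G_def Z4_curve_def)
  fix Q R assume QR: "Q \<in> carrier G" "R \<in> carrier G"
  \<comment> \<open>Closure of the Weierstrass curve makes \<open>inv_into\<close> in the definition
    of the product a genuine preimage.\<close>
  then have "weierstrass_add (Z4_weierstrass c) (Z4_to_weierstrass c Q) (Z4_to_weierstrass c R)
      \<in> Z4_to_weierstrass c ` Z4_points c"
    using bij by (auto simp: G_def Z4_curve_def bij_betw_def intro!: wadd_on_curve[OF assms(1,2)])
  then show "Q \<otimes>\<^bsub>G\<^esub> R \<in> carrier G" "Z4_to_weierstrass c (Q \<otimes>\<^bsub>G\<^esub> R) =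
      weierstrass_add (Z4_weierstrass c) (Z4_to_weierstrass c Q) (Z4_to_weierstrass c R)"
    by (simp_all add: G_def Z4_curve_def inv_into_into f_inv_into_f)
next
  show "kummer G Q = wkummer c (Z4_to_weierstrass c Q)" if "Q \<in> carrier G" for Q
    using that wkummer_Z4_to_weierstrass[OF assms(1,2)] by (simp add: G_def Z4_curve_def)
qed

lemma mu4_curve_transfer:
  assumes "CHAR('k::field) = 2" and "(c::'k) \<noteq> 0"
  defines "G \<equiv> mu4_curve c" and "h \<equiv> Z4_to_weierstrass c \<circ> mu4_to_Z4 c"
  shows "bij_betw h (carrier G) (on_weierstrass (Z4_weierstrass c))"
    and "\<one>\<^bsub>G\<^esub> \<in> carrier G" and "h \<one>\<^bsub>G\<^esub> = At_Infinity"
    and "\<And>Q R. Q \<in> carrier G \<Longrightarrow> R \<in> carrier G \<Longrightarrow> Q \<otimes>\<^bsub>G\<^esub> R \<in> carrier G"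
    and "\<And>Q R. Q \<in> carrier G \<Longrightarrow> R \<in> carrier G \<Longrightarrow>
      h (Q \<otimes>\<^bsub>G\<^esub> R) = weierstrass_add (Z4_weierstrass c) (h Q) (h R)"
    and "\<And>Q. Q \<in> carrier G \<Longrightarrow> kummer G Q = wkummer c (h Q)"
proof -
  note bij = mu4_to_Z4_bij[OF assms(1,2)]
  note Z4 = Z4_curve_transfer[OF assms(1,2)]
  have Z4_carrier: "carrier (Z4_curve c) = Z4_points c" by (simp add: Z4_curve_def)
  have carrier: "carrier G = mu4_points c" by (simp add: G_def mu4_curve_def)
  have into: "mu4_to_Z4 c Q \<in> Z4_points c" if "Q \<in> carrier G" for Q
    using bij that by (auto simp: carrier bij_betw_def)
  show "bij_betw h (carrier G) (on_weierstrass (Z4_weierstrass c))"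
    unfolding h_def carrier by (rule bij_betw_trans[OF bij Z4(1)[unfolded Z4_carrier]])
  show "\<one>\<^bsub>G\<^esub> \<in> carrier G" "h \<one>\<^bsub>G\<^esub> = At_Infinity"
    using mu4_identity[OF assms(1,2)] Z4(3) by (simp_all add: G_def h_def mu4_curve_def Z4_curve_def)
  fix Q R assume QR: "Q \<in> carrier G" "R \<in> carrier G"
  then have "mu4_to_Z4 c Q \<otimes>\<^bsub>Z4_curve c\<^esub> mu4_to_Z4 c R \<in> mu4_to_Z4 c ` mu4_points c"
    using bij Z4(4) into by (simp add: bij_betw_def Z4_carrier)
  then have "Q \<otimes>\<^bsub>G\<^esub> R \<in> carrier G"
    "mu4_to_Z4 c (Q \<otimes>\<^bsub>G\<^esub> R) = mu4_to_Z4 c Q \<otimes>\<^bsub>Z4_curve c\<^esub> mu4_to_Z4 c R"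
    by (simp_all add: G_def mu4_curve_def inv_into_into f_inv_into_f)
  then show "Q \<otimes>\<^bsub>G\<^esub> R \<in> carrier G"
    "h (Q \<otimes>\<^bsub>G\<^esub> R) = weierstrass_add (Z4_weierstrass c) (h Q) (h R)"
    using Z4(5) into QR by (simp_all add: h_def Z4_carrier)
next
  show "kummer G Q = wkummer c (h Q)" if Q: "Q \<in> carrier G" for Q
  proof -
    have "Q \<in> mu4_points c" using Q by (simp add: G_def mu4_curve_def)
    then have "mu4_kummer c Q = Z4_kummer (mu4_to_Z4 c Q)" "mu4_to_Z4 c Q \<in> Z4_points c"
      using mu4_kummer_Z4[OF assms(1,2)] mu4_to_Z4_bij[OF assms(1,2)]
      by (auto simp: bij_betw_def)
    then show ?thesis
      using wkummer_Z4_to_weierstrass[OF assms(1,2)] by (simp add: G_def h_def mu4_curve_def)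
  qed
qed

text \<open>The Kummer coordinates range over the algebraic closure, so all geometric points are
  covered, while \<open>c\<close> and \<open>P\<close> have coordinates in the base field. A
  vanishing \<open>w\<close> names no projective point; the last conjunct confines that case to
  \<open>P\<close> with trivial double.\<close>

theorem theorem25:
  fixes c x0 x1 x2 x3 t0 t1 :: "'k::field"
    and U0 U1 V0 V1 :: "'k alg_closure"
    and G :: "('k alg_closure P3, 'k alg_closure P1) kummer_curve"
    and P :: "'k alg_closure P3"
  assumes "CHAR('k) = 2"
    and "Z4_elliptic (to_ac c)"
    and "G = Z4_curve (to_ac c) \<or> G = mu4_curve (to_ac c)"
    and "P = proj3 (to_ac x0, to_ac x1, to_ac x2, to_ac x3)"
    and "P \<in> carrier G"
    and "proj1 (to_ac t0, to_ac t1) = kummer G P"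
    and "(proj1 (U0, U1), proj1 (V0, V1)) \<in> kummer_Delta G P"
  shows
    "let \<phi> = kummer_montgomery G P;
         z = (proj1 (U0, U1), proj1 (V0, V1));
         w = (to_ac t1 * (U0 * V0 + U1 * V1)^2, to_ac t0 * (U0 * V1 + U1 * V0)^2)
     in fst (\<phi> z) = proj1 (U0^4 + U1^4, to_ac c^2 * U0^2 * U1^2) \<and>
        (w \<noteq> (0, 0) \<longrightarrow> snd (\<phi> z) = proj1 w) \<and>
        (P \<otimes>\<^bsub>G\<^esub> P \<noteq> \<one>\<^bsub>G\<^esub> \<longrightarrow> w \<noteq> (0, 0))"
proof -
  have char2: "CHAR('k alg_closure) = 2" using assms(1) by simp
  have c: "to_ac c \<noteq> 0" using assms(2) Z4_elliptic_iff[OF char2] by simp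
  from assms(3) show ?thesis
  proof
    assume G: "G = Z4_curve (to_ac c)"
    show ?thesis
      unfolding G
      by (rule montgomery_transfer[OF char2 c, where h = "Z4_to_weierstrass (to_ac c)"])
        (rule Z4_curve_transfer[OF char2 c] assms(5-7)[unfolded G] | assumption)+
  next
    assume G: "G = mu4_curve (to_ac c)"
    show ?thesis
      unfolding G
      by (rule montgomery_transfer[OF char2 c, where h = "Z4_to_weierstrass (to_ac c) \<circ> mu4_to_Z4 (to_ac c)"])
        (rule mu4_curve_transfer[OF char2 c] assms(5-7)[unfolded G] | assumption)+
  qed
qed

end
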